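(* Let $n\ge 2$, let $L_1,\dots,L_n>0$ and let $Q=\prod_{i=1}^n[0,L_i]\subset\mathbb{R}^n$ be a rectangular box. Let $f$ be a sum of an $L^1$ function on $Q$ and a compactly supported distribution in the interior of $Q$. Then the integrals of $f$ over all periodic billiard trajectories in $Q$ determine $f$ uniquely; that is, if two such sums have the same integrals over all periodic billiard trajectories in $Q$, then they are equal.
   Context: $\mathbb{T}^n=\mathbb{R}^n/\mathbb{Z}^n$ is identified with $[-1/2,1/2]^n$ with opposite faces glued. Define the folding map $Z:\mathbb{T}^n\to Q$ by $Z(y)=(2L_1|y_1|,\dots,2L_n|y_n|)$ for $y\in[-1/2,1/2]^n$. The periodic billiard trajectories (periodic broken rays, reflecting at the boundary) in $Q$ are the curves $t\mapsto Z(x+tv)$, $t\in[0,1]$, where $x\in\mathbb{T}^n$ and $v\in\mathbb{Z}^n\setminus\{0\}$, i.e. the images under $Z$ of the periodic geodesics $t\mapsto x+tv$ of $\mathbb{T}^n$. For continuous $f$ on $Q$, the integral of $f$ over such a trajectory is, up to a positive constant depending only on the direction $v$ and the $L_i$ (parametrization), $\int_0^1 f(Z(x+tv))\,dt=R\tilde f(x,v)$, where $\tilde f=f\circ Z$ and $Rg(x,v)=\int_0^1g(x+tv)\,dt$ for functions $g$ on $\mathbb{T}^n$. For $f=f_1+f_2$ with $f_1\in L^1(Q)$ and $f_2$ a compactly supported distribution in the interior of $Q$, the integrals are defined by transferring to the torus: $\tilde f\in\mathcal{T}'$, the space of distributions on $\mathbb{T}^n$ (dual of $\mathcal{T}=C^\infty(\mathbb{T}^n)$),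 is the pullback $f\circ Z$, that is, $$\langle\tilde f,\eta\rangle=\Big(\prod_{i=1}^n\tfrac{1}{2L_i}\Big)\Big\langle f,\ x\mapsto\sum_{\varepsilon\in\{-1,1\}^n}\eta\Big(\tfrac{\varepsilon_1x_1}{2L_1},\dots,\tfrac{\varepsilon_nx_n}{2L_n}\Big)\Big\rangle,\qquad\eta\in\mathcal{T},$$ (with $f_1$ acting by integration over $Q$), and the integrals of $f$ over the periodic billiard trajectories are the distributions $R\tilde f(\cdot,v)\in\mathcal{T}'$, $v\in\mathbb{Z}^n\setminus\{0\}$, defined by $\langle R\tilde f(\cdot,v),\eta\rangle=\langle\tilde f,R\eta(\cdot,v)\rangle$ for all $\eta\in\mathcal{T}$. Equality of two sums $f$ means equality as such sums, acting by the pairing on smooth functions on $Q$. *)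

theory Defs
  imports "HOL-Analysis.Analysis"
begin

definition partial_deriv :: "'n \<Rightarrow> (real ^ 'n \<Rightarrow> complex) \<Rightarrow> real ^ 'n \<Rightarrow> complex" where
  "partial_deriv i f x = frechet_derivative f (at x) (axis i 1)"

primrec iter_partial :: "'n list \<Rightarrow> (real ^ 'n \<Rightarrow> complex) \<Rightarrow> real ^ 'n \<Rightarrow> complex" where
  "iter_partial [] f = f"
| "iter_partial (i # is) f = partial_deriv i (iter_partial is f)"

text \<open>Differentiability of a function includes its continuity, so this is the class of functions all
  of whose iterated partial derivatives exist and are continuous.\<close>

definition smooth :: "(real ^ 'n \<Rightarrow> complex) \<Rightarrow> bool" where
  "smooth f \<longleftrightarrow> (\<forall>is x. iter_partial is f differentiable (at x))"

definition fun_supp :: "(real ^ 'n \<Rightarrow> complex) \<Rightarrow> (real ^ 'n) set" where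
  "fun_supp f = closure {x. f x \<noteq> 0}"

text \<open>The space of test functions on an open set \<open>U\<close>, each extended by zero to the whole space.\<close>

definition test_funs :: "(real ^ 'n) set \<Rightarrow> (real ^ 'n \<Rightarrow> complex) set" where
  "test_funs U = {\<phi>. smooth \<phi> \<and> compact (fun_supp \<phi>) \<and> fun_supp \<phi> \<subseteq> U}"

definition Ck_norm :: "nat \<Rightarrow> (real ^ 'n \<Rightarrow> complex) \<Rightarrow> real" where
  "Ck_norm N \<phi> = (\<Sum>is | length is \<le> N. SUP x. norm (iter_partial is \<phi> x))"

text \<open>A distribution on \<open>U\<close> is a functional whose values outside \<open>test_funs U\<close> are irrelevant.\<close>

definition distribution_on ::
    "(real ^ 'n) set \<Rightarrow> ((real ^ 'n \<Rightarrow> complex) \<Rightarrow> complex) \<Rightarrow> bool" where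
  "distribution_on U u \<longleftrightarrow>
     (\<forall>\<phi>\<in>test_funs U. \<forall>\<psi>\<in>test_funs U. \<forall>a b.
        u (\<lambda>x. a * \<phi> x + b * \<psi> x) = a * u \<phi> + b * u \<psi>) \<and>
     (\<forall>K. compact K \<and> K \<subseteq> U \<longrightarrow>
        (\<exists>C N. \<forall>\<phi>\<in>test_funs U. fun_supp \<phi> \<subseteq> K \<longrightarrow> norm (u \<phi>) \<le> C * Ck_norm N \<phi>))"

definition dist_supp ::
    "(real ^ 'n) set \<Rightarrow> ((real ^ 'n \<Rightarrow> complex) \<Rightarrow> complex) \<Rightarrow> (real ^ 'n) set" where
  "dist_supp U u =
     {x \<in> U. \<forall>V. open V \<and> x \<in> V \<and> V \<subseteq> U \<longrightarrow> (\<exists>\<phi>\<in>test_funs V. u \<phi> \<noteq> 0)}"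

definition compactly_supported_distribution_on ::
    "(real ^ 'n) set \<Rightarrow> ((real ^ 'n \<Rightarrow> complex) \<Rightarrow> complex) \<Rightarrow> bool" where
  "compactly_supported_distribution_on U u \<longleftrightarrow> distribution_on U u \<and> compact (dist_supp U u)"

definition cutoff_for ::
    "(real ^ 'n) set \<Rightarrow> ((real ^ 'n \<Rightarrow> complex) \<Rightarrow> complex) \<Rightarrow> (real ^ 'n \<Rightarrow> complex) \<Rightarrow> bool" where
  "cutoff_for U u \<kappa> \<longleftrightarrow>
     \<kappa> \<in> test_funs U \<and> (\<exists>V. open V \<and> dist_supp U u \<subseteq> V \<and> (\<forall>x\<in>V. \<kappa> x = 1))"

text \<open>The action of a compactly supported distribution on a smooth function \<open>\<phi>\<close> that need not
  have compact support: \<open>\<langle>u, \<phi>\<rangle> = \<langle>u, \<kappa>\<phi>\<rangle>\<close>, where \<open>\<kappa>\<close> is a test function equal to \<open>1\<close> near the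
  support of \<open>u\<close>. The value does not depend on the choice of \<open>\<kappa>\<close>.\<close>

definition smooth_action ::
    "(real ^ 'n) set \<Rightarrow> ((real ^ 'n \<Rightarrow> complex) \<Rightarrow> complex) \<Rightarrow> (real ^ 'n \<Rightarrow> complex) \<Rightarrow> complex" where
  "smooth_action U u \<phi> = (let \<kappa> = (SOME \<kappa>. cutoff_for U u \<kappa>) in u (\<lambda>x. \<kappa> x * \<phi> x))"

definition billiard_box :: "real ^ 'n \<Rightarrow> (real ^ 'n) set" where
  "billiard_box L = cbox 0 L"

text \<open>Only the values on \<open>Q\<close> matter.\<close>

definition smooth_funs_on :: "(real ^ 'n) set \<Rightarrow> (real ^ 'n \<Rightarrow> complex) set" where
  "smooth_funs_on Q = {\<phi>. \<exists>\<psi>. smooth \<psi> \<and> (\<forall>x\<in>Q. \<phi> x = \<psi> x)}"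

definition sum_pairing ::
    "(real ^ 'n) set \<Rightarrow> (real ^ 'n \<Rightarrow> complex) \<Rightarrow> ((real ^ 'n \<Rightarrow> complex) \<Rightarrow> complex)
      \<Rightarrow> (real ^ 'n \<Rightarrow> complex) \<Rightarrow> complex" where
  "sum_pairing Q f1 f2 \<phi> = (LINT x:Q|lebesgue. f1 x * \<phi> x) + smooth_action (interior Q) f2 \<phi>"

definition int_vec :: "int ^ 'n \<Rightarrow> real ^ 'n" where
  "int_vec k = (\<chi> i. of_int (k $ i))"

text \<open>Functions on the torus are functions on the whole space with period lattice \<open>\<int>\<^sup>n\<close>.\<close>

definition torus_test_funs :: "(real ^ 'n \<Rightarrow> complex) set" where
  "torus_test_funs = {\<eta>. smooth \<eta> \<and> (\<forall>x k. \<eta> (x + int_vec k) = \<eta> x)}"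

text \<open>The pullback \<open>f \<circ> Z\<close> of a functional \<open>f\<close> on smooth functions on the box under the folding map
  \<open>Z y = (2 L\<^sub>1 \<bar>y\<^sub>1\<bar>, \<dots>, 2 L\<^sub>n \<bar>y\<^sub>n\<bar>)\<close>, \<open>y \<in> [-1/2, 1/2]\<^sup>n\<close>. For each sign vector \<open>\<epsilon>\<close> the map
  \<open>x \<mapsto> (\<epsilon>\<^sub>i x\<^sub>i / (2 L\<^sub>i))\<^sub>i\<close> is a right inverse of \<open>Z\<close>, and these maps parametrize the \<open>2\<^sup>n\<close> cells of
  the torus that \<open>Z\<close> folds onto the box; the product is their Jacobian.\<close>

definition fold_pullback ::
    "real ^ 'n \<Rightarrow> ((real ^ 'n \<Rightarrow> complex) \<Rightarrow> complex) \<Rightarrow> (real ^ 'n \<Rightarrow> complex) \<Rightarrow> complex" where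
  "fold_pullback L f \<eta> =
     of_real (\<Prod>i\<in>UNIV. 1 / (2 * L $ i)) *
     f (\<lambda>x. \<Sum>\<epsilon> | \<forall>i. \<epsilon> $ i \<in> {-1, 1 :: real}. \<eta> (\<chi> i. \<epsilon> $ i * x $ i / (2 * L $ i)))"

definition torus_xray :: "(real ^ 'n \<Rightarrow> complex) \<Rightarrow> int ^ 'n \<Rightarrow> real ^ 'n \<Rightarrow> complex" where
  "torus_xray \<eta> v x = integral {0..1} (\<lambda>t. \<eta> (x + t *\<^sub>R int_vec v))"

definition torus_xray_dist ::
    "((real ^ 'n \<Rightarrow> complex) \<Rightarrow> complex) \<Rightarrow> int ^ 'n \<Rightarrow> (real ^ 'n \<Rightarrow> complex) \<Rightarrow> complex" where
  "torus_xray_dist u v \<eta> = u (torus_xray \<eta> v)"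

text \<open>The integrals of \<open>f = f\<^sub>1 + f\<^sub>2\<close> over the periodic billiard trajectories \<open>t \<mapsto> Z (x + t v)\<close> with
  direction \<open>v\<close>, as a distribution in the initial point \<open>x\<close> on the torus.\<close>

definition billiard_integrals ::
    "real ^ 'n \<Rightarrow> (real ^ 'n \<Rightarrow> complex) \<Rightarrow> ((real ^ 'n \<Rightarrow> complex) \<Rightarrow> complex)
      \<Rightarrow> int ^ 'n \<Rightarrow> (real ^ 'n \<Rightarrow> complex) \<Rightarrow> complex" where
  "billiard_integrals L f1 f2 v =
     torus_xray_dist (fold_pullback L (sum_pairing (billiard_box L) f1 f2)) v"

end

theory Submission
  imports Defs "HOL-Computational_Algebra.Polynomial"
begin

text \<open>
  Let \<open>D\<close> be the difference of the pairings with the two sums. A direction \<open>v \<noteq> 0\<close> in \<open>\<int>\<^sup>n\<close> orthogonal to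
  a given \<open>k\<close> in \<open>\<int>\<^sup>n\<close> exists since \<open>n \<ge> 2\<close>. The exponential with frequency \<open>k\<close> on the torus is constant
  along the lines with direction \<open>v\<close>, so it equals its own X-ray transform in that direction. Folding
  it onto the box gives the cosine wave \<open>\<Prod>\<^sub>i 2 cos (\<pi> k\<^sub>i x\<^sub>i / L\<^sub>i)\<close>. Hence the hypothesis says that \<open>D\<close>
  vanishes on all cosine waves (\<open>billiard_integrals_plane_wave\<close>).

  On smooth functions \<open>D\<close> is continuous for some \<open>C\<^sup>N\<close> norm on the box (\<open>sum_pairing_bound\<close>). Cosine waves
  are not dense in that norm among all smooth functions, as they satisfy Neumann conditions, but
  their closure contains the test functions on the open box (\<open>test_funs_approximation\<close>). This is
  reduced to uniform approximation, that is, to the Stone--Weierstrass theorem (\<open>cosine_span_dense\<close>), by means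
  of the operators \<open>1 - \<partial>\<^sub>i\<^sup>2\<close>: they are invertible on the span of the cosine waves, and a maximum
  principle (\<open>neumann_maximum_principle\<close>) shows that products of them control all the derivatives
  of functions with Neumann conditions (\<open>iter_partial_bounded_by_iter_helmholtz\<close>). So \<open>D\<close> vanishes on
  test functions (\<open>functional_vanishes_on_test_funs\<close>).

  For an arbitrary smooth \<open>\<psi>\<close> take cutoffs \<open>\<theta>\<^sub>m\<close> that tend to \<open>1\<close> in the open box and are equal to \<open>1\<close> on
  the supports of the cutoffs that define the two distributional parts. Then \<open>D (\<theta>\<^sub>m \<psi>) = 0\<close>, and
  \<open>D ((1 - \<theta>\<^sub>m) \<psi>)\<close> involves the integrable parts alone, so it tends to \<open>0\<close> by dominated convergence
  (\<open>integral_off_cutoffs_tendsto_0\<close>). Therefore \<open>D \<psi> = 0\<close>.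
\<close>

section \<open>Calculus of smooth functions\<close>

lemma partial_deriv_eqI:
  assumes "(f has_derivative f') (at x)"
  shows "partial_deriv i f x = f' (axis i 1)"
  using frechet_derivative_at[OF assms] by (simp add: partial_deriv_def)

lemma iter_partial_append: "iter_partial (xs @ ys) f = iter_partial xs (iter_partial ys f)"
  by (induction xs) auto

lemma smooth_differentiable: "smooth f \<Longrightarrow> f differentiable (at x)"
  unfolding smooth_def by (metis iter_partial.simps(1))

lemma smooth_iter_partial: "smooth f \<Longrightarrow> smooth (iter_partial is f)"
  unfolding smooth_def by (metis iter_partial_append)

lemma smooth_partial_deriv: "smooth f \<Longrightarrow> smooth (partial_deriv i f)"
  using smooth_iter_partial[of f "[i]"] by simp

lemma smooth_continuous_on: "smooth f \<Longrightarrow> continuous_on S f"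
  by (meson smooth_differentiable differentiable_imp_continuous_on differentiable_on_def
      differentiable_at_withinI)

text \<open>Smoothness is the greatest property that entails differentiability and passes to partial
  derivatives. All the closure properties below come from a class of functions that is visibly
  stable under \<open>\<partial>\<^sub>i\<close>.\<close>

lemma smooth_coinduct:
  assumes "f \<in> S"
    and "\<And>g x. g \<in> S \<Longrightarrow> g differentiable (at x)"
    and "\<And>g i. g \<in> S \<Longrightarrow> partial_deriv i g \<in> S"
  shows "smooth f"
proof -
  have "iter_partial is f \<in> S" for "is"
    by (induction "is") (use assms in auto)
  then show ?thesis
    using assms(2) by (auto simp: smooth_def)
qed

lemma partial_deriv_const: "partial_deriv i (\<lambda>x. c) = (\<lambda>x. 0)"
  by (rule ext, subst partial_deriv_eqI[OF has_derivative_const]) auto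

lemma partial_deriv_add:
  assumes "\<And>x. f differentiable (at x)" "\<And>x. g differentiable (at x)"
  shows "partial_deriv i (\<lambda>x. f x + g x) = (\<lambda>x. partial_deriv i f x + partial_deriv i g x)"
proof
  fix x
  obtain f' g' where *: "(f has_derivative f') (at x)" "(g has_derivative g') (at x)"
    using assms unfolding differentiable_def by metis
  show "partial_deriv i (\<lambda>x. f x + g x) x = partial_deriv i f x + partial_deriv i g x"
    using partial_deriv_eqI[OF has_derivative_add[OF *]] partial_deriv_eqI[OF *(1)]
      partial_deriv_eqI[OF *(2)] by simp
qed

lemma partial_deriv_mult:
  assumes "\<And>x. f differentiable (at x)" "\<And>x. g differentiable (at x)"
  shows "partial_deriv i (\<lambda>x. f x * g x) =
    (\<lambda>x. partial_deriv i f x * g x + f x * partial_deriv i g x)"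
proof
  fix x
  obtain f' g' where *: "(f has_derivative f') (at x)" "(g has_derivative g') (at x)"
    using assms unfolding differentiable_def by metis
  show "partial_deriv i (\<lambda>x. f x * g x) x = partial_deriv i f x * g x + f x * partial_deriv i g x"
    using partial_deriv_eqI[OF has_derivative_mult[OF *]] partial_deriv_eqI[OF *(1)]
      partial_deriv_eqI[OF *(2)] by simp
qed

lemma partial_deriv_cmult:
  assumes "\<And>x. f differentiable (at x)"
  shows "partial_deriv i (\<lambda>x. c * f x) = (\<lambda>x. c * partial_deriv i f x)"
  using partial_deriv_mult[of "\<lambda>x. c" f i] assms by (simp add: partial_deriv_const)

text \<open>The partial derivatives of a product or a composition are not of the same form, but by the
  Leibniz and chain rules they stay in an algebra generated by such functions. Since \<open>\<partial>\<^sub>i\<close> respects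
  sums and products in this sense, only the generators have to be checked.\<close>

inductive_set generated_algebra :: "(real ^ 'n \<Rightarrow> complex) set \<Rightarrow> (real ^ 'n \<Rightarrow> complex) set"
  for G where
  generator: "g \<in> G \<Longrightarrow> g \<in> generated_algebra G"
| const: "(\<lambda>x. c) \<in> generated_algebra G"
| sum: "f \<in> generated_algebra G \<Longrightarrow> g \<in> generated_algebra G \<Longrightarrow>
    (\<lambda>x. f x + g x) \<in> generated_algebra G"
| product: "f \<in> generated_algebra G \<Longrightarrow> g \<in> generated_algebra G \<Longrightarrow>
    (\<lambda>x. f x * g x) \<in> generated_algebra G"

lemma smooth_generated_algebra:
  assumes G: "\<And>g x. g \<in> G \<Longrightarrow> g differentiable (at x)"
    "\<And>g i. g \<in> G \<Longrightarrow> partial_deriv i g \<in> generated_algebra G"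
    and f: "f \<in> generated_algebra G"
  shows "smooth f"
proof (rule smooth_coinduct[OF f])
  have *: "(\<forall>x. g differentiable (at x)) \<and> (\<forall>i. partial_deriv i g \<in> generated_algebra G)"
    if "g \<in> generated_algebra G" for g
    using that
  proof induction
    case (generator g)
    then show ?case using G by blast
  next
    case (const c)
    then show ?case
      by (auto simp: partial_deriv_const intro: generated_algebra.const)
  next
    case (sum f g)
    then show ?case
      by (auto simp: partial_deriv_add intro: generated_algebra.sum)
  next
    case (product f g)
    then show ?case
      by (auto simp: partial_deriv_mult intro!: generated_algebra.sum generated_algebra.product)
  qed
  then show "g differentiable (at x)" if "g \<in> generated_algebra G" for g x
    using that by blast
  show "partial_deriv i g \<in> generated_algebra G" if "g \<in> generated_algebra G" for g i
    using * that by blast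
qed

lemma smooth_generated_by_smooth:
  assumes "f \<in> generated_algebra {g. smooth g}"
  shows "smooth f"
  using smooth_generated_algebra[OF _ _ assms]
  by (auto intro: smooth_differentiable generated_algebra.generator smooth_partial_deriv)

lemma smooth_const: "smooth (\<lambda>x. c)"
  by (rule smooth_generated_by_smooth) (rule generated_algebra.const)

lemma smooth_add: "smooth f \<Longrightarrow> smooth g \<Longrightarrow> smooth (\<lambda>x. f x + g x)"
  by (rule smooth_generated_by_smooth) (auto intro: generated_algebra.intros)

lemma smooth_mult: "smooth f \<Longrightarrow> smooth g \<Longrightarrow> smooth (\<lambda>x. f x * g x)"
  by (rule smooth_generated_by_smooth) (auto intro: generated_algebra.intros)

lemma smooth_diff: "smooth f \<Longrightarrow> smooth g \<Longrightarrow> smooth (\<lambda>x. f x - g x)"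
  using smooth_add[of f "\<lambda>x. (-1) * g x"] smooth_mult[OF smooth_const, of g "-1"] by simp

lemma smooth_sum: "finite A \<Longrightarrow> (\<And>a. a \<in> A \<Longrightarrow> smooth (f a)) \<Longrightarrow> smooth (\<lambda>x. \<Sum>a\<in>A. f a x)"
  by (induction A rule: finite_induct) (auto intro: smooth_const smooth_add)

lemma smooth_prod: "finite A \<Longrightarrow> (\<And>a. a \<in> A \<Longrightarrow> smooth (f a)) \<Longrightarrow> smooth (\<lambda>x. \<Prod>a\<in>A. f a x)"
  by (induction A rule: finite_induct) (auto intro: smooth_const smooth_mult)

lemma partial_deriv_diff:
  assumes "smooth f" "smooth g"
  shows "partial_deriv i (\<lambda>x. f x - g x) = (\<lambda>x. partial_deriv i f x - partial_deriv i g x)"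
  using partial_deriv_add[of f "\<lambda>x. (-1) * g x" i] partial_deriv_cmult[of g i "-1"]
    smooth_differentiable[OF assms(1)] smooth_differentiable[OF assms(2)]
    smooth_differentiable[OF smooth_mult[OF smooth_const assms(2)]]
  by simp

lemma partial_deriv_sum:
  assumes "finite A" "\<And>a. a \<in> A \<Longrightarrow> smooth (f a)"
  shows "partial_deriv i (\<lambda>x. \<Sum>a\<in>A. f a x) = (\<lambda>x. \<Sum>a\<in>A. partial_deriv i (f a) x)"
  using assms
proof (induction A rule: finite_induct)
  case empty
  then show ?case by (simp add: partial_deriv_const)
next
  case (insert a A)
  have "partial_deriv i (\<lambda>x. f a x + (\<Sum>a\<in>A. f a x)) =
     (\<lambda>x. partial_deriv i (f a) x + partial_deriv i (\<lambda>x. \<Sum>a\<in>A. f a x) x)"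
    using insert by (intro partial_deriv_add smooth_differentiable smooth_sum) auto
  with insert show ?case by simp
qed

lemma smooth_coordinate: "smooth (\<lambda>x::real^'n. of_real (x $ i))"
proof -
  have d: "((\<lambda>x::real^'n. complex_of_real (x $ i)) has_derivative (\<lambda>h. of_real (h $ i))) (at x)" for x :: "real^'n"
    by (intro bounded_linear_imp_has_derivative)
      (auto intro: bounded_linear_compose[OF bounded_linear_of_real bounded_linear_vec_nth])
  have "partial_deriv j (\<lambda>x::real^'n. complex_of_real (x $ i)) = (\<lambda>x. of_real (axis j 1 $ i))" for j
    by (rule ext) (rule partial_deriv_eqI[OF d])
  with d show ?thesis
    by (intro smooth_generated_algebra[where G="{\<lambda>x::real^'n. complex_of_real (x $ i)}"])
      (auto intro!: generated_algebra.intros simp: differentiable_def)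
qed

text \<open>The algebra is generated by the smooth functions and all \<open>D n \<circ> g\<close>; the chain rule
  \<open>\<partial>\<^sub>i (D n \<circ> g) = (D (Suc n) \<circ> g) \<partial>\<^sub>i g\<close> keeps the generators inside it. The sequence \<open>D\<close> stands
  for the successive derivatives of \<open>D 0\<close>.\<close>

lemma smooth_compose_real:
  fixes g :: "real ^ 'n \<Rightarrow> real" and D :: "nat \<Rightarrow> real \<Rightarrow> real"
  assumes D: "\<And>n t. (D n has_real_derivative D (Suc n) t) (at t)"
    and g: "smooth (\<lambda>x. of_real (g x))"
  shows "smooth (\<lambda>x. of_real (D n (g x)))"
proof -
  define G where "G = {f. smooth f} \<union> range (\<lambda>n x. complex_of_real (D n (g x)))"
  have d: "\<exists>g'. ((\<lambda>x. complex_of_real (D n (g x))) has_derivative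
       (\<lambda>h. of_real (D (Suc n) (g x)) * g' h)) (at x) \<and>
       ((\<lambda>x. complex_of_real (g x)) has_derivative g') (at x)" for n x
  proof -
    obtain g' where g': "((\<lambda>x. complex_of_real (g x)) has_derivative g') (at x)"
      using smooth_differentiable[OF g] unfolding differentiable_def by blast
    have r: "(g has_derivative (\<lambda>h. Re (g' h))) (at x)"
      using bounded_linear.has_derivative[OF bounded_linear_Re g'] by simp
    have "((\<lambda>x. complex_of_real (g x)) has_derivative (\<lambda>h. of_real (Re (g' h)))) (at x)"
      by (rule bounded_linear.has_derivative[OF bounded_linear_of_real r])
    then have eq: "g' = (\<lambda>h. of_real (Re (g' h)))"
      using g' has_derivative_unique by blast
    have "((\<lambda>x. D n (g x)) has_derivative (\<lambda>h. D (Suc n) (g x) * Re (g' h))) (at x)"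
      using has_derivative_compose[OF r, of "D n" "(*) (D (Suc n) (g x))"] D[of n "g x"]
      by (simp add: has_field_derivative_def)
    from bounded_linear.has_derivative[OF bounded_linear_of_real this]
    have "((\<lambda>x. complex_of_real (D n (g x))) has_derivative
       (\<lambda>h. of_real (D (Suc n) (g x)) * of_real (Re (g' h)))) (at x)"
      by simp
    then show ?thesis using g' eq by metis
  qed
  have p: "partial_deriv i (\<lambda>x. complex_of_real (D n (g x))) =
     (\<lambda>x. of_real (D (Suc n) (g x)) * partial_deriv i (\<lambda>x. complex_of_real (g x)) x)" for i n
    by (rule ext) (use d partial_deriv_eqI in metis)
  have gen: "(\<lambda>x. complex_of_real (D n (g x))) \<in> generated_algebra G" for n
    by (rule generated_algebra.generator) (auto simp: G_def)
  show ?thesis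
  proof (rule smooth_generated_algebra[OF _ _ gen])
    fix f x assume "f \<in> G"
    then show "f differentiable (at x)"
      unfolding G_def using d smooth_differentiable[of f x] by (auto simp: differentiable_def)
  next
    fix f i assume "f \<in> G"
    then consider "smooth f" | n where "f = (\<lambda>x. complex_of_real (D n (g x)))"
      by (auto simp: G_def)
    then show "partial_deriv i f \<in> generated_algebra G"
    proof cases
      case 1
      then show ?thesis
        by (auto intro!: generated_algebra.generator simp: G_def smooth_partial_deriv)
    next
      case 2
      then show ?thesis
        unfolding 2 p by (intro generated_algebra.product gen generated_algebra.generator)
          (auto simp: G_def smooth_partial_deriv g)
    qed
  qed
qed

lemma has_vector_derivative_line:
  assumes "smooth f"
  shows "((\<lambda>t. f (x + t *\<^sub>R axis i 1)) has_vector_derivative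
    partial_deriv i f (x + t *\<^sub>R axis i 1)) (at t within S)"
proof -
  obtain f' where f': "(f has_derivative f') (at (x + t *\<^sub>R axis i 1))"
    using smooth_differentiable[OF assms] unfolding differentiable_def by blast
  have "((\<lambda>t. x + t *\<^sub>R axis i 1) has_derivative (\<lambda>t. t *\<^sub>R axis i 1)) (at t within S)"
    by (auto intro!: derivative_eq_intros)
  from has_derivative_compose[OF this f']
  have "((\<lambda>t. f (x + t *\<^sub>R axis i 1)) has_derivative (\<lambda>t. f' (t *\<^sub>R axis i 1))) (at t within S)" .
  moreover have "f' (s *\<^sub>R axis i 1) = s *\<^sub>R f' (axis i 1)" for s
    using f' has_derivative_linear linear_scale by metis
  ultimately show ?thesis
    by (simp add: has_vector_derivative_def partial_deriv_eqI[OF f'])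
qed

section \<open>Equality of mixed partial derivatives\<close>

text \<open>The mean value theorem, first in direction \<open>i\<close> and then in direction \<open>j\<close>. The left-hand side
  is symmetric in \<open>i\<close> and \<open>j\<close>, which is what makes the mixed derivatives agree. A real-valued
  functional \<open>r\<close>, later the real or imaginary part, is needed since the mean value theorem fails for
  complex values.\<close>

lemma mixed_difference_mean_value:
  fixes f :: "real ^ 'n \<Rightarrow> complex" and r :: "complex \<Rightarrow> real"
  assumes f: "smooth f" and r: "bounded_linear r" and h: "h > 0"
  shows "\<exists>s t. 0 < s \<and> s < h \<and> 0 < t \<and> t < h \<and>
    r (f (x + h *\<^sub>R axis i 1 + h *\<^sub>R axis j 1) - f (x + h *\<^sub>R axis i 1)
       - f (x + h *\<^sub>R axis j 1) + f x) =
    h ^ 2 * r (partial_deriv j (partial_deriv i f) (x + s *\<^sub>R axis i 1 + t *\<^sub>R axis j 1))"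
proof -
  interpret r: bounded_linear r by fact
  have line: "((\<lambda>t. r (g (y + t *\<^sub>R axis k 1))) has_real_derivative
      r (partial_deriv k g (y + t *\<^sub>R axis k 1))) (at t)" if "smooth g" for g y k t
    using r.has_vector_derivative[OF has_vector_derivative_line[OF that]]
    by (simp add: has_real_derivative_iff_has_vector_derivative)
  define \<phi> where "\<phi> s = r (f ((x + h *\<^sub>R axis j 1) + s *\<^sub>R axis i 1)) - r (f (x + s *\<^sub>R axis i 1))" for s
  have "\<exists>s>0. s < h \<and> \<phi> h - \<phi> 0 = (h - 0) * (r (partial_deriv i f ((x + h *\<^sub>R axis j 1) + s *\<^sub>R axis i 1))
        - r (partial_deriv i f (x + s *\<^sub>R axis i 1)))"
    by (rule MVT2[OF h]) (auto simp: \<phi>_def intro!: DERIV_diff line f)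
  then obtain s where s: "s > 0" "s < h" "\<phi> h - \<phi> 0 = h * (r (partial_deriv i f ((x + h *\<^sub>R axis j 1) + s *\<^sub>R axis i 1))
        - r (partial_deriv i f (x + s *\<^sub>R axis i 1)))" by auto
  have "\<exists>t>0. t < h \<and> r (partial_deriv i f ((x + s *\<^sub>R axis i 1) + h *\<^sub>R axis j 1))
      - r (partial_deriv i f ((x + s *\<^sub>R axis i 1) + 0 *\<^sub>R axis j 1)) =
      (h - 0) * r (partial_deriv j (partial_deriv i f) ((x + s *\<^sub>R axis i 1) + t *\<^sub>R axis j 1))"
    by (rule MVT2[OF h]) (auto intro!: line f smooth_partial_deriv)
  then obtain t where t: "t > 0" "t < h" "r (partial_deriv i f ((x + s *\<^sub>R axis i 1) + h *\<^sub>R axis j 1))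
      - r (partial_deriv i f (x + s *\<^sub>R axis i 1)) =
      h * r (partial_deriv j (partial_deriv i f) ((x + s *\<^sub>R axis i 1) + t *\<^sub>R axis j 1))"
    by auto
  have "r (f (x + h *\<^sub>R axis i 1 + h *\<^sub>R axis j 1) - f (x + h *\<^sub>R axis i 1)
       - f (x + h *\<^sub>R axis j 1) + f x) = \<phi> h - \<phi> 0"
    by (simp add: \<phi>_def r.diff r.add algebra_simps)
  also have "\<dots> = h * (h * r (partial_deriv j (partial_deriv i f) ((x + s *\<^sub>R axis i 1) + t *\<^sub>R axis j 1)))"
    using s(3) t(3) by (simp add: algebra_simps)
  finally show ?thesis
    using s t by (auto simp: power2_eq_square)
qed

text \<open>Clairaut's theorem: as \<open>h\<close> tends to \<open>0\<close>, the two expressions for the mixed difference converge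
  to the two mixed derivatives by continuity.\<close>

lemma partial_deriv_commute:
  fixes f :: "real ^ 'n \<Rightarrow> complex"
  assumes f: "smooth f"
  shows "partial_deriv i (partial_deriv j f) = partial_deriv j (partial_deriv i f)"
proof
  fix x
  have key: "r (partial_deriv i (partial_deriv j f) x) = r (partial_deriv j (partial_deriv i f) x)"
    if r: "bounded_linear r" for r :: "complex \<Rightarrow> real"
  proof -
    have lim: "((\<lambda>y. r (partial_deriv k (partial_deriv l f) y)) \<longlongrightarrow>
        r (partial_deriv k (partial_deriv l f) x)) (at x)" for k l
    proof (rule bounded_linear.tendsto[OF r])
      have "continuous_on UNIV (partial_deriv k (partial_deriv l f))"
        using f by (intro smooth_continuous_on smooth_partial_deriv)
      then show "(partial_deriv k (partial_deriv l f) \<longlongrightarrow> partial_deriv k (partial_deriv l f) x) (at x)"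
        by (simp add: continuous_on_eq_continuous_at isCont_def)
    qed
    have "\<bar>r (partial_deriv i (partial_deriv j f) x) - r (partial_deriv j (partial_deriv i f) x)\<bar> \<le> e"
      if e: "e > 0" for e
    proof -
      have near: "\<exists>d>0. \<forall>y. dist y x < d \<longrightarrow>
         \<bar>r (partial_deriv k (partial_deriv l f) y) - r (partial_deriv k (partial_deriv l f) x)\<bar> < e / 2" for k l
      proof -
        \<comment> \<open>The limit says nothing about the point itself, where the estimate is trivial.\<close>
        from LIM_D[OF lim[of k l], of "e/2"] e obtain d where "d > 0"
          "\<forall>y. y \<noteq> x \<and> norm (y - x) < d \<longrightarrow> norm (r (partial_deriv k (partial_deriv l f) y) - r (partial_deriv k (partial_deriv l f) x)) < e / 2"
          by auto
        moreover have "\<bar>r (partial_deriv k (partial_deriv l f) y) - r (partial_deriv k (partial_deriv l f) x)\<bar> < e / 2"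
          if "y = x" for y
          using that e by simp
        ultimately show ?thesis
          by (intro exI[of _ d]) (metis dist_norm real_norm_def)
      qed
      obtain d1 where d1: "d1 > 0" "\<forall>y. dist y x < d1 \<longrightarrow>
         \<bar>r (partial_deriv i (partial_deriv j f) y) - r (partial_deriv i (partial_deriv j f) x)\<bar> < e / 2"
        using near by blast
      obtain d2 where d2: "d2 > 0" "\<forall>y. dist y x < d2 \<longrightarrow>
         \<bar>r (partial_deriv j (partial_deriv i f) y) - r (partial_deriv j (partial_deriv i f) x)\<bar> < e / 2"
        using near by blast
      \<comment> \<open>Both points produced by the mean value theorem lie within \<open>2 h < min d1 d2\<close> of \<open>x\<close>.\<close>
      define h where "h = min d1 d2 / 3"
      have h: "h > 0" using d1 d2 by (simp add: h_def)
      have close: "dist (x + s *\<^sub>R axis k 1 + t *\<^sub>R axis l 1) x < min d1 d2"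
        if "0 < s" "s < h" "0 < t" "t < h" for s t and k l :: 'n
      proof -
        have "dist (x + s *\<^sub>R axis k 1 + t *\<^sub>R axis l 1) x = norm (s *\<^sub>R axis k (1::real) + t *\<^sub>R axis l 1)"
          by (simp add: dist_norm add.assoc)
        also have "\<dots> \<le> norm (s *\<^sub>R axis k (1::real)) + norm (t *\<^sub>R axis l (1::real))"
          by (rule norm_triangle_ineq)
        also have "\<dots> = s + t" using that by simp
        also have "\<dots> < min d1 d2" using that h by (simp add: h_def)
        finally show ?thesis .
      qed
      obtain s t where st: "0 < s" "s < h" "0 < t" "t < h"
         "r (f (x + h *\<^sub>R axis i 1 + h *\<^sub>R axis j 1) - f (x + h *\<^sub>R axis i 1)
       - f (x + h *\<^sub>R axis j 1) + f x) =
          h ^ 2 * r (partial_deriv j (partial_deriv i f) (x + s *\<^sub>R axis i 1 + t *\<^sub>R axis j 1))"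
        using mixed_difference_mean_value[OF f r h, where x=x and i=i and j=j] by blast
      obtain s' t' where st': "0 < s'" "s' < h" "0 < t'" "t' < h"
         "r (f (x + h *\<^sub>R axis j 1 + h *\<^sub>R axis i 1) - f (x + h *\<^sub>R axis j 1)
       - f (x + h *\<^sub>R axis i 1) + f x) =
          h ^ 2 * r (partial_deriv i (partial_deriv j f) (x + s' *\<^sub>R axis j 1 + t' *\<^sub>R axis i 1))"
        using mixed_difference_mean_value[OF f r h, where x=x and i=j and j=i] by blast
      have "f (x + h *\<^sub>R axis j 1 + h *\<^sub>R axis i 1) - f (x + h *\<^sub>R axis j 1)
       - f (x + h *\<^sub>R axis i 1) + f x = f (x + h *\<^sub>R axis i 1 + h *\<^sub>R axis j 1) - f (x + h *\<^sub>R axis i 1)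
       - f (x + h *\<^sub>R axis j 1) + f x"
        by (simp add: algebra_simps)
      with st(5) st'(5) h have
        "r (partial_deriv j (partial_deriv i f) (x + s *\<^sub>R axis i 1 + t *\<^sub>R axis j 1)) =
         r (partial_deriv i (partial_deriv j f) (x + s' *\<^sub>R axis j 1 + t' *\<^sub>R axis i 1))"
        by simp
      moreover have "\<bar>r (partial_deriv j (partial_deriv i f) (x + s *\<^sub>R axis i 1 + t *\<^sub>R axis j 1))
          - r (partial_deriv j (partial_deriv i f) x)\<bar> < e / 2"
        using d2(2) close[OF st(1-4)] by simp
      moreover have "\<bar>r (partial_deriv i (partial_deriv j f) (x + s' *\<^sub>R axis j 1 + t' *\<^sub>R axis i 1))
          - r (partial_deriv i (partial_deriv j f) x)\<bar> < e / 2"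
        using d1(2) close[OF st'(1-4)] by simp
      ultimately show ?thesis by linarith
    qed
    then show ?thesis
      using field_le_epsilon[of "\<bar>r (partial_deriv i (partial_deriv j f) x) - r (partial_deriv j (partial_deriv i f) x)\<bar>" 0] by simp
  qed
  show "partial_deriv i (partial_deriv j f) x = partial_deriv j (partial_deriv i f) x"
    using key[OF bounded_linear_Re] key[OF bounded_linear_Im] by (simp add: complex_eq_iff)
qed

section \<open>Smooth cutoff functions\<close>

text \<open>The derivatives of \<open>t \<mapsto> exp (- 1 / t)\<close>, extended by \<open>0\<close> to \<open>t \<le> 0\<close>, all have this form.\<close>

definition flat_times_poly :: "real poly \<Rightarrow> real \<Rightarrow> real" where
  "flat_times_poly p t = (if t > 0 then poly p (1 / t) * exp (- 1 / t) else 0)"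

lemma poly_div_exp_tendsto_0: "((\<lambda>x. poly p x / exp x) \<longlongrightarrow> (0::real)) at_top"
proof -
  have "((\<lambda>x. \<Sum>i\<le>degree p. coeff p i * (x ^ i / exp x)) \<longlongrightarrow> (\<Sum>i\<le>degree p. coeff p i * 0)) at_top"
    by (intro tendsto_intros tendsto_power_div_exp_0)
  then show ?thesis
    by (simp add: poly_altdef sum_divide_distrib)
qed

text \<open>At \<open>t = 0\<close> the difference quotient is \<open>p(s) s / exp s\<close> with \<open>s = 1 / t\<close> for \<open>t > 0\<close>, and tends to \<open>0\<close>.\<close>

lemma flat_times_poly_derivative:
  "(flat_times_poly p has_real_derivative flat_times_poly (monom 1 2 * (p - pderiv p)) t) (at t)"
proof -
  consider "t > 0" | "t < 0" | "t = 0" by linarith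
  then show ?thesis
  proof cases
    case 1
    have "((\<lambda>t. poly p (1 / t) * exp (- 1 / t)) has_real_derivative
        flat_times_poly (monom 1 2 * (p - pderiv p)) t) (at t)"
    proof -
      have inv: "((\<lambda>t. 1 / t) has_real_derivative - (1 / t ^ 2)) (at t)"
        using 1 by (auto intro!: derivative_eq_intros simp: power2_eq_square)
      have "((\<lambda>t. poly p (1 / t)) has_real_derivative poly (pderiv p) (1 / t) * - (1 / t ^ 2)) (at t)"
        by (rule DERIV_chain2[OF poly_DERIV inv])
      moreover have "((\<lambda>t. exp (- (1 / t))) has_real_derivative exp (- (1 / t)) * - (- (1 / t ^ 2))) (at t)"
        by (rule DERIV_chain2[OF DERIV_exp DERIV_minus[OF inv]])
      ultimately have "((\<lambda>t. poly p (1 / t) * exp (- (1 / t))) has_real_derivative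
          poly (pderiv p) (1 / t) * - (1 / t ^ 2) * exp (- (1 / t))
          + exp (- (1 / t)) * - (- (1 / t ^ 2)) * poly p (1 / t)) (at t)"
        by (rule DERIV_mult)
      then show ?thesis
        using 1 by (simp add: flat_times_poly_def poly_monom power_one_over algebra_simps)
    qed
    then show ?thesis
      by (rule has_field_derivative_transform_within_open[of _ _ _ "{0<..}"])
        (use 1 in \<open>auto simp: flat_times_poly_def\<close>)
  next
    case 2
    have "((\<lambda>t. 0) has_real_derivative flat_times_poly (monom 1 2 * (p - pderiv p)) t) (at t)"
      using 2 by (auto simp: flat_times_poly_def)
    then show ?thesis
      by (rule has_field_derivative_transform_within_open[of _ _ _ "{..<0}"])
        (use 2 in \<open>auto simp: flat_times_poly_def\<close>)
  next
    case 3
    have "((\<lambda>s. flat_times_poly p s / s) \<longlongrightarrow> 0) (at_left 0)"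
      by (rule tendsto_eventually) (auto simp: eventually_at_left_field flat_times_poly_def intro!: exI[of _ "-1"])
    moreover have "((\<lambda>s. flat_times_poly p s / s) \<longlongrightarrow> 0) (at_right 0)"
      unfolding filterlim_at_right_to_top
    proof (rule Lim_transform_eventually[OF poly_div_exp_tendsto_0[of "pCons 0 p"]])
      show "\<forall>\<^sub>F x in at_top. poly (pCons 0 p) x / exp x =
          flat_times_poly p (inverse x) / inverse x"
        using eventually_gt_at_top[of 0]
        by eventually_elim (simp add: flat_times_poly_def exp_minus field_simps)
    qed
    ultimately show ?thesis
      unfolding 3 has_field_derivative_iff
      by (auto simp: filterlim_at_split flat_times_poly_def[of _ 0])
  qed
qed

definition flat :: "real \<Rightarrow> real" where
  "flat t = (if t > 0 then exp (- 1 / t) else 0)"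

lemma smooth_flat:
  assumes "smooth (\<lambda>x. of_real (g x))"
  shows "smooth (\<lambda>x. of_real (flat (g x)))"
proof -
  \<comment> \<open>The polynomial factor of the \<open>n\<close>-th derivative.\<close>
  define P where "P n = ((\<lambda>p::real poly. monom 1 2 * (p - pderiv p)) ^^ n) 1" for n
  have "(flat_times_poly (P n) has_real_derivative flat_times_poly (P (Suc n)) t) (at t)" for n t
    using flat_times_poly_derivative[of "P n" t] by (simp add: P_def)
  from smooth_compose_real[where D="\<lambda>n. flat_times_poly (P n)" and n=0, OF this assms]
  have "smooth (\<lambda>x. of_real (flat_times_poly 1 (g x)))" by (simp add: P_def)
  moreover have "flat_times_poly 1 t = flat t" for t
    by (simp add: flat_times_poly_def flat_def)
  ultimately show ?thesis by simp
qed

lemma flat_nonneg: "flat t \<ge> 0"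
  by (simp add: flat_def)

lemma flat_pos_iff: "flat t > 0 \<longleftrightarrow> t > 0"
  by (simp add: flat_def)

lemma flat_le_flat_one: "t \<le> 1 \<Longrightarrow> flat t \<le> flat 1"
  by (auto simp: flat_def field_simps)

lemma smooth_of_real_diff:
  assumes "smooth (\<lambda>x. of_real (f x))" "smooth (\<lambda>x. of_real (g x))"
  shows "smooth (\<lambda>x. of_real (f x - g x))"
  using smooth_diff[OF assms] by simp

lemma compact_subset_box_margin:
  fixes L :: "real ^ 'n"
  assumes "compact K" "K \<subseteq> box 0 L"
  shows "\<exists>a>0. \<forall>x\<in>K. \<forall>i. a < x $ i \<and> x $ i < L $ i - a"
proof -
  obtain e where e: "e > 0" "(\<Union>x\<in>K. ball x e) \<subseteq> box 0 L"
    using compact_subset_open_imp_ball_epsilon_subset[OF assms(1) open_box assms(2)] by metis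
  have "e / 2 < x $ i \<and> x $ i < L $ i - e / 2" if "x \<in> K" for x i
  proof -
    have "x - (e / 2) *\<^sub>R axis i 1 \<in> ball x e" "x + (e / 2) *\<^sub>R axis i 1 \<in> ball x e"
      using e by (auto simp: dist_norm)
    then have "x - (e / 2) *\<^sub>R axis i 1 \<in> box 0 L" "x + (e / 2) *\<^sub>R axis i 1 \<in> box 0 L"
      using e that by blast+
    then show ?thesis
      by (auto simp: mem_box_cart dest!: spec[of _ i])
  qed
  then show ?thesis using e by (intro exI[of _ "e/2"]) auto
qed

lemma compact_fun_supp:
  assumes "compact K" "fun_supp f \<subseteq> K"
  shows "compact (fun_supp f)"
proof -
  have "compact (K \<inter> fun_supp f)"
    using assms(1) by (rule compact_Int_closed) (simp add: fun_supp_def)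
  then show ?thesis using assms(2) by (simp add: Int_absorb1)
qed

text \<open>The product \<open>\<rho>\<close> of flat functions of the distances to the faces of a slightly smaller box is
  smooth, positive in that box and zero outside it. Since \<open>\<rho>\<close> is bounded below on \<open>K\<close>, a second use
  of the flat function turns it into a cutoff. The values lie in \<open>[0, 1]\<close>, which later gives an
  integrable majorant.\<close>

lemma smooth_cutoff_exists:
  fixes L :: "real ^ 'n"
  assumes K: "compact K" "K \<subseteq> box 0 L"
  obtains \<theta> V where "(\<lambda>x. complex_of_real (\<theta> x)) \<in> test_funs (box 0 L)"
    "\<And>x. 0 \<le> \<theta> x" "\<And>x. \<theta> x \<le> 1" "open V" "K \<subseteq> V" "\<And>x. x \<in> V \<Longrightarrow> \<theta> x = 1"
proof -
  obtain a where a: "a > 0" "\<And>x i. x \<in> K \<Longrightarrow> a < x $ i \<and> x $ i < L $ i - a"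
    using compact_subset_box_margin[OF K] by blast
  define \<rho> where "\<rho> x = (\<Prod>i\<in>UNIV. flat (x $ i - a) * flat (L $ i - a - x $ i))" for x :: "real^'n"
  have sm: "smooth (\<lambda>x. of_real (\<rho> x))"
    unfolding \<rho>_def of_real_prod of_real_mult
    by (intro smooth_prod smooth_mult smooth_flat smooth_of_real_diff smooth_coordinate smooth_const) auto
  have cont: "continuous_on S \<rho>" for S
    using continuous_on_Re[OF smooth_continuous_on[OF sm]] by simp
  have nonneg: "\<rho> x \<ge> 0" for x
    unfolding \<rho>_def by (intro prod_nonneg) (simp add: flat_nonneg)
  have pos: "\<rho> x > 0" if "x \<in> K" for x
    unfolding \<rho>_def using a(2)[OF that] by (intro prod_pos) (simp add: flat_pos_iff)
  have zero: "\<rho> x = 0" if zero_out: "x \<notin> cbox (\<chi> i. a) (\<chi> i. L $ i - a)" for x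
    proof -
    obtain i where "flat (x $ i - a) * flat (L $ i - a - x $ i) = 0"
    proof -
      have "\<exists>i. \<not> (a \<le> x $ i \<and> x $ i \<le> L $ i - a)"
        using zero_out by (simp add: mem_box_cart)
      then obtain i where "\<not> (a \<le> x $ i \<and> x $ i \<le> L $ i - a)" by blast
      then show thesis by (intro that[of i]) (auto simp: flat_def)
    qed
    then show ?thesis unfolding \<rho>_def by (intro prod_zero) auto
  qed
  obtain c where c: "c > 0" "\<And>x. x \<in> K \<Longrightarrow> \<rho> x > c"
  proof (cases "K = {}")
    case True
    then show ?thesis using that[of 1] by simp
  next
    case False
    then obtain y where y: "y \<in> K" "\<forall>x\<in>K. \<rho> y \<le> \<rho> x"
      using continuous_attains_inf[OF K(1) False cont] by blast
    have "0 < \<rho> y / 2" using pos[OF y(1)] by simp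
    moreover have "\<rho> y / 2 < \<rho> x" if "x \<in> K" for x
      using y(2) that pos[OF y(1)] by force
    ultimately show ?thesis by (rule that)
  qed
  \<comment> \<open>The inner argument is at most \<open>0\<close> where \<open>\<rho> \<ge> c\<close>, so that \<open>\<theta> = 1\<close> there, and it is \<open>1\<close> where \<open>\<rho> = 0\<close>,
    so that \<open>\<theta> = 0\<close> there.\<close>
  define \<theta> where "\<theta> x = 1 - flat (1 - \<rho> x / c) * (1 / flat 1)" for x
  have f1: "flat 1 > 0" by (simp add: flat_pos_iff)
  have "smooth (\<lambda>x. of_real (\<rho> x) * of_real (1 / c))"
    by (intro smooth_mult sm smooth_const)
  then have "smooth (\<lambda>x. of_real (\<rho> x / c))" by simp
  then have "smooth (\<lambda>x. of_real (flat (1 - \<rho> x / c)) * of_real (1 / flat 1))"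
    by (intro smooth_mult smooth_flat smooth_of_real_diff smooth_const)
  then have sm\<theta>: "smooth (\<lambda>x. of_real (\<theta> x))"
    unfolding \<theta>_def by (intro smooth_of_real_diff smooth_const) simp
  have le1: "1 - \<rho> x / c \<le> 1" for x using nonneg c by simp
  have supp: "fun_supp (\<lambda>x. complex_of_real (\<theta> x)) \<subseteq> cbox (\<chi> i. a) (\<chi> i. L $ i - a)"
    unfolding fun_supp_def
  proof (rule closure_minimal)
    show "{x. complex_of_real (\<theta> x) \<noteq> 0} \<subseteq> cbox (\<chi> i. a) (\<chi> i. L $ i - a)"
    proof
      fix x assume "x \<in> {x. complex_of_real (\<theta> x) \<noteq> 0}"
      then have "\<rho> x \<noteq> 0" using f1 by (auto simp: \<theta>_def)
      then show "x \<in> cbox (\<chi> i. a) (\<chi> i. L $ i - a)" using zero by blast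
    qed
  qed auto
  show thesis
  proof (rule that[of \<theta> "{x. c < \<rho> x}"])
    have "compact (fun_supp (\<lambda>x. complex_of_real (\<theta> x)))"
      by (rule compact_fun_supp[OF compact_cbox supp])
    moreover have "cbox (\<chi> i. a) (\<chi> i. L $ i - a) \<subseteq> box 0 L"
    proof
      fix x :: "real ^ 'n" assume "x \<in> cbox (\<chi> i. a) (\<chi> i. L $ i - a)"
      then have x: "a \<le> x $ i" "x $ i \<le> L $ i - a" for i by (auto simp: mem_box_cart)
      have "0 < x $ i \<and> x $ i < L $ i" for i using x[of i] a(1) by linarith
      then show "x \<in> box 0 L" by (simp add: mem_box_cart)
    qed
    ultimately show "(\<lambda>x. complex_of_real (\<theta> x)) \<in> test_funs (box 0 L)"
      using sm\<theta> supp by (auto simp: test_funs_def)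
    show "0 \<le> \<theta> x" "\<theta> x \<le> 1" for x
      using flat_le_flat_one[OF le1, of x] flat_nonneg f1 by (auto simp: \<theta>_def)
    show "open {x. c < \<rho> x}"
      by (intro open_Collect_less cont continuous_on_const)
    show "K \<subseteq> {x. c < \<rho> x}" using c by auto
    show "\<theta> x = 1" if "x \<in> {x. c < \<rho> x}" for x
      using that c by (simp add: \<theta>_def flat_def)
  qed
qed

section \<open>Test functions and distributions of finite order\<close>

lemma fun_supp_zero: "x \<notin> fun_supp f \<Longrightarrow> f x = 0"
  unfolding fun_supp_def using closure_subset[of "{x. f x \<noteq> 0}"] by blast

lemma test_funs_smooth: "f \<in> test_funs U \<Longrightarrow> smooth f"
  by (simp add: test_funs_def)

lemma test_funs_zero: "f \<in> test_funs U \<Longrightarrow> x \<notin> U \<Longrightarrow> f x = 0"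
  unfolding test_funs_def using fun_supp_zero[of x f] by blast

lemma test_funs_supp_mono:
  assumes "f \<in> test_funs U" "smooth g" "fun_supp g \<subseteq> fun_supp f"
  shows "g \<in> test_funs U"
proof -
  have "compact (fun_supp g)"
    using assms by (intro compact_fun_supp[OF _ assms(3)]) (simp add: test_funs_def)
  moreover have "fun_supp g \<subseteq> U"
    using assms(1,3) unfolding test_funs_def by blast
  ultimately show ?thesis using assms(2) by (simp add: test_funs_def)
qed

lemma fun_supp_mult: "fun_supp (\<lambda>x. f x * g x) \<subseteq> fun_supp f"
  unfolding fun_supp_def by (rule closure_mono) auto

lemma test_funs_mult:
  assumes "f \<in> test_funs U" "smooth g"
  shows "(\<lambda>x. f x * g x) \<in> test_funs U"
  using test_funs_supp_mono[OF assms(1), of "\<lambda>x. f x * g x"] fun_supp_mult[of f g]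
    smooth_mult[OF test_funs_smooth[OF assms(1)] assms(2)] by blast

lemma fun_supp_partial_deriv: "fun_supp (partial_deriv i f) \<subseteq> fun_supp f"
proof -
  have "partial_deriv i f x = 0" if "x \<notin> fun_supp f" for x
  proof -
    have "((\<lambda>x. 0) has_derivative (\<lambda>h. 0)) (at x)" by simp
    then have "(f has_derivative (\<lambda>h. 0)) (at x)"
      by (rule has_derivative_transform_within_open[of _ _ _ _ "- fun_supp f"])
        (use that fun_supp_zero in \<open>auto simp: fun_supp_def\<close>)
    then show ?thesis by (rule partial_deriv_eqI)
  qed
  then have "{x. partial_deriv i f x \<noteq> 0} \<subseteq> fun_supp f" by blast
  moreover have "closed (fun_supp f)" by (simp add: fun_supp_def)
  ultimately show ?thesis
    unfolding fun_supp_def[of "partial_deriv i f"] by (rule closure_minimal)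
qed

lemma test_funs_partial_deriv:
  assumes "f \<in> test_funs U"
  shows "partial_deriv i f \<in> test_funs U"
  using test_funs_supp_mono[OF assms, of "partial_deriv i f"] fun_supp_partial_deriv[of i f]
    smooth_partial_deriv[OF test_funs_smooth[OF assms]] by blast

lemma test_funs_add:
  assumes "f \<in> test_funs U" "g \<in> test_funs U"
  shows "(\<lambda>x. f x + g x) \<in> test_funs U"
proof -
  have "fun_supp (\<lambda>x. f x + g x) \<subseteq> fun_supp f \<union> fun_supp g"
    unfolding fun_supp_def closure_Un[symmetric] by (rule closure_mono) auto
  moreover have "compact (fun_supp f \<union> fun_supp g)"
    using assms by (auto simp: test_funs_def)
  ultimately have "compact (fun_supp (\<lambda>x. f x + g x))"
    by (intro compact_fun_supp[of "fun_supp f \<union> fun_supp g"])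
  then show ?thesis
    using assms \<open>fun_supp (\<lambda>x. f x + g x) \<subseteq> _\<close> by (auto simp: test_funs_def smooth_add)
qed

lemma test_funs_bounded:
  assumes "f \<in> test_funs U"
  shows "\<exists>B>0. \<forall>x. norm (f x) \<le> B"
proof -
  have "compact (f ` fun_supp f)"
    using assms by (auto simp: test_funs_def intro!: compact_continuous_image smooth_continuous_on)
  then obtain B where B: "B > 0" "\<forall>y\<in>f ` fun_supp f. norm y \<le> B"
    using compact_imp_bounded bounded_pos by blast
  have "norm (f x) \<le> B" for x
    using B fun_supp_zero[of x f] by (cases "x \<in> fun_supp f") auto
  then show ?thesis using B(1) by blast
qed

lemma iter_partial_add:
  assumes "smooth f" "smooth g"
  shows "iter_partial is (\<lambda>x. f x + g x) = (\<lambda>x. iter_partial is f x + iter_partial is g x)"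
  by (induction "is")
    (simp_all add: partial_deriv_add smooth_differentiable smooth_iter_partial assms)

text \<open>By the Leibniz rule each derivative of \<open>\<kappa> \<phi>\<close> is a sum of products of derivatives of \<open>\<kappa>\<close>, which
  are bounded, and derivatives of \<open>\<phi>\<close> of no larger order, which matter on \<open>U\<close> only.\<close>

lemma test_times_smooth_iter_bound:
  fixes \<kappa> :: "real ^ 'n \<Rightarrow> complex"
  assumes "\<kappa> \<in> test_funs U"
  shows "\<exists>C\<ge>0. \<forall>\<phi> e. smooth \<phi> \<and>
      (\<forall>is x. length is \<le> length js \<and> x \<in> U \<longrightarrow> norm (iter_partial is \<phi> x) \<le> e) \<and> e \<ge> 0 \<longrightarrow>
      (\<forall>x. norm (iter_partial js (\<lambda>x. \<kappa> x * \<phi> x) x) \<le> C * e)"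
  using assms
proof (induction js arbitrary: \<kappa> rule: rev_induct)
  case Nil
  obtain B where B: "B > 0" "\<And>x. norm (\<kappa> x) \<le> B" using test_funs_bounded[OF Nil] by blast
  show ?case
  proof (intro exI[of _ B] conjI allI impI)
    fix \<phi> :: "real^'n \<Rightarrow> complex" and e x
    assume *: "smooth \<phi> \<and> (\<forall>is x. length is \<le> length ([]::'n list) \<and> x \<in> U \<longrightarrow> norm (iter_partial is \<phi> x) \<le> e) \<and> e \<ge> 0"
    show "norm (iter_partial [] (\<lambda>x. \<kappa> x * \<phi> x) x) \<le> B * e"
    proof (cases "x \<in> U")
      case True
      then have "norm (\<phi> x) \<le> e" using * by (metis iter_partial.simps(1) le_refl)
      then show ?thesis using B by (auto simp: norm_mult intro!: mult_mono)
    next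
      case False
      then show ?thesis using * B test_funs_zero[OF Nil] by simp
    qed
  qed (use B in simp)
next
  case (snoc j js)
  obtain C1 where C1: "C1 \<ge> 0" "\<And>\<phi> e x. smooth \<phi> \<Longrightarrow>
      (\<And>is x. length is \<le> length js \<Longrightarrow> x \<in> U \<Longrightarrow> norm (iter_partial is \<phi> x) \<le> e) \<Longrightarrow> e \<ge> 0 \<Longrightarrow>
      norm (iter_partial js (\<lambda>x. \<kappa> x * \<phi> x) x) \<le> C1 * e"
    using snoc.IH[OF snoc.prems] by metis
  obtain C2 where C2: "C2 \<ge> 0" "\<And>\<phi> e x. smooth \<phi> \<Longrightarrow>
      (\<And>is x. length is \<le> length js \<Longrightarrow> x \<in> U \<Longrightarrow> norm (iter_partial is \<phi> x) \<le> e) \<Longrightarrow> e \<ge> 0 \<Longrightarrow>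
      norm (iter_partial js (\<lambda>x. partial_deriv j \<kappa> x * \<phi> x) x) \<le> C2 * e"
    using snoc.IH[OF test_funs_partial_deriv[OF snoc.prems]] by metis
  show ?case
  proof (intro exI[of _ "C2 + C1"] conjI allI impI)
    fix \<phi> :: "real^'n \<Rightarrow> complex" and e x
    assume "smooth \<phi> \<and> (\<forall>is x. length is \<le> length (js @ [j]) \<and> x \<in> U \<longrightarrow> norm (iter_partial is \<phi> x) \<le> e) \<and> e \<ge> 0"
    then have \<phi>: "smooth \<phi>" and e: "e \<ge> 0"
      and b: "\<And>is x. length is \<le> Suc (length js) \<Longrightarrow> x \<in> U \<Longrightarrow> norm (iter_partial is \<phi> x) \<le> e" by auto
    have s: "smooth \<kappa>" using snoc.prems by (rule test_funs_smooth)
    \<comment> \<open>The innermost derivative comes first, so that \<open>\<partial>\<^sub>j \<kappa>\<close> is again a test function and the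
      induction hypothesis applies to it in place of \<open>\<kappa>\<close>.\<close>
    have "iter_partial (js @ [j]) (\<lambda>x. \<kappa> x * \<phi> x) x =
        iter_partial js (\<lambda>x. partial_deriv j \<kappa> x * \<phi> x) x + iter_partial js (\<lambda>x. \<kappa> x * partial_deriv j \<phi> x) x"
      by (simp add: iter_partial_append partial_deriv_mult smooth_differentiable s \<phi>
          iter_partial_add smooth_mult smooth_partial_deriv)
    moreover have "norm (iter_partial js (\<lambda>x. partial_deriv j \<kappa> x * \<phi> x) x) \<le> C2 * e"
      by (rule C2(2)[OF \<phi> _ e]) (use b in auto)
    moreover have "norm (iter_partial js (\<lambda>x. \<kappa> x * partial_deriv j \<phi> x) x) \<le> C1 * e"
    proof (rule C1(2)[OF smooth_partial_deriv[OF \<phi>] _ e])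
      fix "is" :: "'n list" and x assume "length is \<le> length js" "x \<in> U"
      then show "norm (iter_partial is (partial_deriv j \<phi>) x) \<le> e"
        using b[of "is @ [j]" x] by (simp add: iter_partial_append)
    qed
    ultimately show "norm (iter_partial (js @ [j]) (\<lambda>x. \<kappa> x * \<phi> x) x) \<le> (C2 + C1) * e"
      unfolding distrib_right by (simp only:) (rule norm_triangle_mono)
  qed (use C1 C2 in simp)
qed

text \<open>A distribution cut off by a test function is of finite order and is controlled by finitely
  many derivatives on \<open>U\<close>. This is the only form in which the continuity of distributions enters.\<close>

lemma distribution_cutoff_bound:
  fixes \<kappa> :: "real ^ 'n \<Rightarrow> complex"
  assumes u: "distribution_on U u" and \<kappa>: "\<kappa> \<in> test_funs U"
  shows "\<exists>C N. C \<ge> 0 \<and> (\<forall>\<phi> e. smooth \<phi> \<and> e \<ge> 0 \<and>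
      (\<forall>is x. length is \<le> N \<and> x \<in> U \<longrightarrow> norm (iter_partial is \<phi> x) \<le> e) \<longrightarrow>
      norm (u (\<lambda>x. \<kappa> x * \<phi> x)) \<le> C * e)"
proof -
  have "compact (fun_supp \<kappa>) \<and> fun_supp \<kappa> \<subseteq> U" using \<kappa> by (auto simp: test_funs_def)
  then obtain C N where CN: "\<forall>\<phi>\<in>test_funs U. fun_supp \<phi> \<subseteq> fun_supp \<kappa> \<longrightarrow> norm (u \<phi>) \<le> C * Ck_norm N \<phi>"
    using u unfolding distribution_on_def by blast
  obtain D where D: "\<And>js. D js \<ge> 0" "\<And>js \<phi> e x. smooth \<phi> \<Longrightarrow>
      (\<And>is x. length is \<le> length js \<Longrightarrow> x \<in> U \<Longrightarrow> norm (iter_partial is \<phi> x) \<le> e) \<Longrightarrow> e \<ge> 0 \<Longrightarrow>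
      norm (iter_partial js (\<lambda>x. \<kappa> x * \<phi> x) x) \<le> D js * e"
    using test_times_smooth_iter_bound[OF \<kappa>] by metis
  define A where "A = (\<Sum>js | length js \<le> N. D js)"
  show ?thesis
  proof (intro exI[of _ "\<bar>C\<bar> * A"] exI[of _ N] conjI allI impI)
    show "0 \<le> \<bar>C\<bar> * A" using D(1) by (auto simp: A_def intro!: sum_nonneg mult_nonneg_nonneg)
    fix \<phi> e assume *: "smooth \<phi> \<and> e \<ge> 0 \<and> (\<forall>is x. length is \<le> N \<and> x \<in> U \<longrightarrow> norm (iter_partial is \<phi> x) \<le> e)"
    have b: "norm (iter_partial js (\<lambda>x. \<kappa> x * \<phi> x) x) \<le> D js * e" if "length js \<le> N" for js x
      using * that by (intro D(2)) auto
    have "Ck_norm N (\<lambda>x. \<kappa> x * \<phi> x) \<le> (\<Sum>js | length js \<le> N. D js * e)"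
      unfolding Ck_norm_def by (intro sum_mono cSUP_least) (auto intro: b)
    then have le: "Ck_norm N (\<lambda>x. \<kappa> x * \<phi> x) \<le> A * e" by (simp add: A_def sum_distrib_right)
    \<comment> \<open>The constant supplied for \<open>u\<close> may be negative, so the norm itself has to be nonnegative
      before the constant can be replaced by its absolute value.\<close>
    have nn: "Ck_norm N (\<lambda>x. \<kappa> x * \<phi> x) \<ge> 0"
      unfolding Ck_norm_def
    proof (intro sum_nonneg)
      fix js assume "js \<in> {js :: 'n list. length js \<le> N}"
      then have "bdd_above (range (\<lambda>x. norm (iter_partial js (\<lambda>x. \<kappa> x * \<phi> x) x)))"
        using b[of js] by (auto simp: bdd_above_def)
      from cSUP_upper[OF UNIV_I this] show "0 \<le> (SUP x. norm (iter_partial js (\<lambda>x. \<kappa> x * \<phi> x) x))"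
        by (meson norm_ge_zero order_trans)
    qed
    have "norm (u (\<lambda>x. \<kappa> x * \<phi> x)) \<le> C * Ck_norm N (\<lambda>x. \<kappa> x * \<phi> x)"
      using CN test_funs_mult[OF \<kappa>] fun_supp_mult * by blast
    also have "\<dots> \<le> \<bar>C\<bar> * Ck_norm N (\<lambda>x. \<kappa> x * \<phi> x)"
      using nn by (intro mult_right_mono) auto
    also have "\<dots> \<le> \<bar>C\<bar> * (A * e)" by (intro mult_left_mono le) auto
    finally show "norm (u (\<lambda>x. \<kappa> x * \<phi> x)) \<le> \<bar>C\<bar> * A * e" by (simp add: mult.assoc)
  qed
qed

section \<open>Cosine waves on the box\<close>

definition plane_wave :: "real ^ 'n \<Rightarrow> real ^ 'n \<Rightarrow> complex" where
  "plane_wave a x = cis (a \<bullet> x)"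

lemma partial_deriv_plane_wave:
  "plane_wave a differentiable (at x)"
  "partial_deriv i (plane_wave a) = (\<lambda>x. \<i> * of_real (a $ i) * plane_wave a x)"
proof -
  have d: "(plane_wave a has_derivative (\<lambda>h. \<i> * of_real (a \<bullet> h) * plane_wave a x)) (at x)" for x
  proof -
    have "((\<lambda>x. a \<bullet> x) has_derivative (\<lambda>h. a \<bullet> h)) (at x)"
      by (intro derivative_eq_intros) auto
    from bounded_linear.has_derivative[OF bounded_linear_of_real this]
    have "((\<lambda>x. complex_of_real (a \<bullet> x)) has_derivative (\<lambda>h. of_real (a \<bullet> h))) (at x)" .
    then have l: "((\<lambda>x. \<i> * complex_of_real (a \<bullet> x)) has_derivative (\<lambda>h. \<i> * of_real (a \<bullet> h))) (at x)"
      by (rule has_derivative_mult_right)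
    have "(exp has_derivative (*) (exp (\<i> * complex_of_real (a \<bullet> x)))) (at (\<i> * complex_of_real (a \<bullet> x)))"
      using DERIV_exp by (simp add: has_field_derivative_def)
    from has_derivative_compose[OF l this] show ?thesis
      by (simp add: plane_wave_def[abs_def] cis_conv_exp mult.commute)
  qed
  show "plane_wave a differentiable (at x)" using d by (auto simp: differentiable_def)
  show "partial_deriv i (plane_wave a) = (\<lambda>x. \<i> * of_real (a $ i) * plane_wave a x)"
    using partial_deriv_eqI[OF d] by (auto simp: inner_axis)
qed

lemma smooth_plane_wave: "smooth (plane_wave a)"
proof (rule smooth_generated_algebra[where G = "{plane_wave a}"])
  have gen: "plane_wave a \<in> generated_algebra {plane_wave a}"
    by (rule generated_algebra.generator) simp
  then show "plane_wave a \<in> generated_algebra {plane_wave a}" .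
  show "partial_deriv i g \<in> generated_algebra {plane_wave a}" if "g \<in> {plane_wave a}" for g i
    using that generated_algebra.product[OF generated_algebra.const gen]
    by (simp add: partial_deriv_plane_wave)
qed (simp add: partial_deriv_plane_wave)

definition sign_vectors :: "(real ^ 'n) set" where
  "sign_vectors = {\<epsilon>. \<forall>i. \<epsilon> $ i \<in> {-1, 1}}"

lemma finite_sign_vectors: "finite (sign_vectors :: (real ^ 'n) set)"
proof -
  have "(sign_vectors :: (real ^ 'n) set) \<subseteq> (\<lambda>f. \<chi> i. f i) ` (PiE UNIV (\<lambda>_. {-1, 1}))"
  proof
    fix \<epsilon> :: "real ^ 'n" assume "\<epsilon> \<in> sign_vectors"
    then have "(\<lambda>i. \<epsilon> $ i) \<in> PiE UNIV (\<lambda>_. {-1, 1})" by (auto simp: sign_vectors_def)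
    moreover have "\<epsilon> = (\<chi> i. \<epsilon> $ i)" by simp
    ultimately show "\<epsilon> \<in> (\<lambda>f. \<chi> i. f i) ` (PiE UNIV (\<lambda>_. {-1, 1}))" by blast
  qed
  then show ?thesis
    by (rule finite_subset) (intro finite_imageI finite_PiE, auto)
qed

definition wave_vector :: "real ^ 'n \<Rightarrow> int ^ 'n \<Rightarrow> real ^ 'n \<Rightarrow> real ^ 'n" where
  "wave_vector L k \<epsilon> = (\<chi> j. pi * of_int (k $ j) * \<epsilon> $ j / L $ j)"

text \<open>This is \<open>\<Prod>\<^sub>i 2 cos (\<pi> k\<^sub>i x\<^sub>i / L\<^sub>i)\<close>. The sum over sign vectors is kept because the pullback under
  the folding map produces it in this form, and because it is differentiated term by term.\<close>

definition cosine_wave :: "real ^ 'n \<Rightarrow> int ^ 'n \<Rightarrow> real ^ 'n \<Rightarrow> complex" where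
  "cosine_wave L k x = (\<Sum>\<epsilon>\<in>sign_vectors. plane_wave (wave_vector L k \<epsilon>) x)"

lemma smooth_cosine_wave: "smooth (cosine_wave L k)"
  unfolding cosine_wave_def[abs_def]
  by (intro smooth_sum finite_sign_vectors smooth_plane_wave)

lemma partial_deriv_cosine_wave:
  "partial_deriv i (cosine_wave L k) =
    (\<lambda>x. \<Sum>\<epsilon>\<in>sign_vectors. \<i> * of_real (wave_vector L k \<epsilon> $ i) * plane_wave (wave_vector L k \<epsilon>) x)"
  unfolding cosine_wave_def[abs_def]
  by (subst partial_deriv_sum)
    (auto simp: finite_sign_vectors smooth_plane_wave partial_deriv_plane_wave)

text \<open>The waves are eigenfunctions of \<open>\<partial>\<^sub>i\<^sup>2\<close>, as the eigenvalue does not depend on the signs. The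
  first derivative leads to sines instead.\<close>

lemma second_partial_deriv_cosine_wave:
  "partial_deriv i (partial_deriv i (cosine_wave L k)) =
    (\<lambda>x. - of_real ((pi * of_int (k $ i) / L $ i)\<^sup>2) * cosine_wave L k x)"
proof
  fix x
  have sq: "(wave_vector L k \<epsilon> $ i)\<^sup>2 = (pi * of_int (k $ i) / L $ i)\<^sup>2" if "\<epsilon> \<in> sign_vectors" for \<epsilon>
  proof -
    have "(\<epsilon> $ i)\<^sup>2 = 1" using that by (auto simp: sign_vectors_def dest!: spec[of _ i])
    then show ?thesis by (simp add: wave_vector_def power_mult_distrib power_divide)
  qed
  have "partial_deriv i (partial_deriv i (cosine_wave L k)) x =
     (\<Sum>\<epsilon>\<in>sign_vectors. \<i> * of_real (wave_vector L k \<epsilon> $ i) *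
        (\<i> * of_real (wave_vector L k \<epsilon> $ i) * plane_wave (wave_vector L k \<epsilon>) x))"
    unfolding partial_deriv_cosine_wave
    by (subst partial_deriv_sum)
      (auto simp: finite_sign_vectors smooth_plane_wave smooth_mult smooth_const
        partial_deriv_cmult partial_deriv_plane_wave)
  also have "\<dots> = (\<Sum>\<epsilon>\<in>sign_vectors. - of_real ((wave_vector L k \<epsilon> $ i)\<^sup>2) * plane_wave (wave_vector L k \<epsilon>) x)"
    by (intro sum.cong refl) (simp add: power2_eq_square algebra_simps)
  also have "\<dots> = (\<Sum>\<epsilon>\<in>sign_vectors. - of_real ((pi * of_int (k $ i) / L $ i)\<^sup>2) * plane_wave (wave_vector L k \<epsilon>) x)"
    by (intro sum.cong refl) (simp only: sq)
  finally show "partial_deriv i (partial_deriv i (cosine_wave L k)) x =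
      - of_real ((pi * of_int (k $ i) / L $ i)\<^sup>2) * cosine_wave L k x"
    by (simp add: cosine_wave_def sum_distrib_left)
qed

text \<open>The Neumann condition on the faces orthogonal to direction \<open>i\<close>: the wave is invariant under
  the reflections in these faces.\<close>

lemma cosine_wave_neumann:
  fixes L x :: "real ^ 'n"
  assumes "L $ i > 0" "x $ i = 0 \<or> x $ i = L $ i"
  shows "partial_deriv i (cosine_wave L k) x = 0"
proof -
  define flip :: "real ^ 'n \<Rightarrow> real ^ 'n" where "flip \<epsilon> = (\<chi> j. if j = i then - \<epsilon> $ j else \<epsilon> $ j)" for \<epsilon>
  define F where "F \<epsilon> = \<i> * of_real (wave_vector L k \<epsilon> $ i) * plane_wave (wave_vector L k \<epsilon>) x" for \<epsilon>
  have flip2: "flip (flip \<epsilon>) = \<epsilon>" for \<epsilon> by (simp add: flip_def vec_eq_iff)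
  \<comment> \<open>Flipping the sign of \<open>\<epsilon>\<^sub>i\<close> leaves the exponential unchanged at such a point but changes the sign of
    the factor that the derivative brings down, so the terms cancel in pairs.\<close>
  have bij: "bij_betw flip sign_vectors sign_vectors"
  proof (rule bij_betw_byWitness[where f'=flip])
    show "flip ` sign_vectors \<subseteq> sign_vectors" "flip ` sign_vectors \<subseteq> sign_vectors"
      by (simp_all add: flip_def sign_vectors_def image_subset_iff) blast+
  qed (simp_all add: flip2)
  have "F (flip \<epsilon>) = - F \<epsilon>" if \<epsilon>: "\<epsilon> \<in> sign_vectors" for \<epsilon>
  proof -
    have "wave_vector L k \<epsilon> = wave_vector L k (flip \<epsilon>) + (2 * pi * of_int (k $ i) * \<epsilon> $ i / L $ i) *\<^sub>R axis i 1"
      by (simp add: wave_vector_def flip_def vec_eq_iff axis_def)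
    then have "wave_vector L k \<epsilon> \<bullet> x = wave_vector L k (flip \<epsilon>) \<bullet> x + (2 * pi * of_int (k $ i) * \<epsilon> $ i / L $ i) * x $ i"
      by (simp add: inner_add_left inner_axis')
    moreover have "cis ((2 * pi * of_int (k $ i) * \<epsilon> $ i / L $ i) * x $ i) = 1"
    proof -
      have "\<epsilon> $ i = 1 \<or> \<epsilon> $ i = -1" using \<epsilon> by (auto simp: sign_vectors_def dest!: spec[of _ i])
      then have "\<exists>n::int. (2 * pi * of_int (k $ i) * \<epsilon> $ i / L $ i) * x $ i = 2 * pi * of_int n"
        using assms by (auto intro: exI[of _ 0] exI[of _ "k $ i"] exI[of _ "- (k $ i)"])
      then show ?thesis by (auto intro: cis_multiple_2pi)
    qed
    ultimately have "plane_wave (wave_vector L k (flip \<epsilon>)) x = plane_wave (wave_vector L k \<epsilon>) x"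
      by (simp add: plane_wave_def flip: cis_mult)
    moreover have "wave_vector L k (flip \<epsilon>) $ i = - wave_vector L k \<epsilon> $ i"
      by (simp add: wave_vector_def flip_def)
    ultimately show ?thesis by (simp add: F_def)
  qed
  then have "sum F sign_vectors = sum (\<lambda>\<epsilon>. - F \<epsilon>) sign_vectors"
    using sum.reindex_bij_betw[OF bij, of F] by simp
  then have "sum F sign_vectors = 0" by (simp add: sum_negf)
  then show ?thesis by (simp add: partial_deriv_cosine_wave F_def)
qed

text \<open>The addition formula \<open>2 cos a cos b = cos (a + b) + cos (a - b)\<close> in coordinate \<open>i\<close>.\<close>

lemma cosine_wave_times_cos:
  "of_real (cos (pi * x $ i / L $ i)) * cosine_wave L k x =
    1 / 2 * cosine_wave L (k + axis i 1) x + 1 / 2 * cosine_wave L (k - axis i 1) x"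
proof -
  have "of_real (cos (pi * x $ i / L $ i)) * plane_wave (wave_vector L k \<epsilon>) x =
     1 / 2 * plane_wave (wave_vector L (k + axis i 1) \<epsilon>) x + 1 / 2 * plane_wave (wave_vector L (k - axis i 1) \<epsilon>) x"
    if \<epsilon>: "\<epsilon> \<in> sign_vectors" for \<epsilon>
  proof -
    define t where "t = pi * \<epsilon> $ i / L $ i * x $ i"
    have "wave_vector L (k + axis i 1) \<epsilon> = wave_vector L k \<epsilon> + (pi * \<epsilon> $ i / L $ i) *\<^sub>R axis i 1"
      "wave_vector L (k - axis i 1) \<epsilon> = wave_vector L k \<epsilon> - (pi * \<epsilon> $ i / L $ i) *\<^sub>R axis i 1"
      by (auto simp: wave_vector_def vec_eq_iff axis_def algebra_simps diff_divide_distrib add_divide_distrib)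
    then have "wave_vector L (k + axis i 1) \<epsilon> \<bullet> x = wave_vector L k \<epsilon> \<bullet> x + t"
      "wave_vector L (k - axis i 1) \<epsilon> \<bullet> x = wave_vector L k \<epsilon> \<bullet> x - t"
      by (auto simp: inner_add_left inner_diff_left inner_axis' t_def)
    moreover have "cos (pi * x $ i / L $ i) = cos t"
    proof -
      have "\<epsilon> $ i = 1 \<or> \<epsilon> $ i = -1" using \<epsilon> by (auto simp: sign_vectors_def dest!: spec[of _ i])
      then show ?thesis by (auto simp: t_def)
    qed
    moreover have "cis (s + t) + cis (s - t) = 2 * of_real (cos t) * cis s" for s
      by (simp add: complex_eq_iff cos_add sin_add cos_diff sin_diff)
    ultimately show ?thesis by (simp add: plane_wave_def flip: add_divide_distrib)
  qed
  then show ?thesis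
    by (simp add: cosine_wave_def sum_distrib_left flip: sum.distrib)
qed

lemma cosine_wave_0:
  fixes L x :: "real ^ 'n"
  shows
  "cosine_wave L 0 x = of_nat (card (sign_vectors :: (real ^ 'n) set))"
  "card (sign_vectors :: (real ^ 'n) set) > 0"
proof -
  have "wave_vector L 0 \<epsilon> = 0" for \<epsilon> by (simp add: wave_vector_def vec_eq_iff)
  then show "cosine_wave L 0 x = of_nat (card (sign_vectors :: (real ^ 'n) set))"
    by (simp add: cosine_wave_def plane_wave_def)
  have "(\<chi> i. (1 :: real)) \<in> (sign_vectors :: (real ^ 'n) set)" by (simp add: sign_vectors_def)
  then show "card (sign_vectors :: (real ^ 'n) set) > 0"
    using finite_sign_vectors card_gt_0_iff by blast
qed

inductive_set cosine_span :: "real ^ 'n \<Rightarrow> (real ^ 'n \<Rightarrow> complex) set" for L where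
  wave: "(\<lambda>x. c * cosine_wave L k x) \<in> cosine_span L"
| add: "p \<in> cosine_span L \<Longrightarrow> q \<in> cosine_span L \<Longrightarrow> (\<lambda>x. p x + q x) \<in> cosine_span L"

lemma smooth_cosine_span: "p \<in> cosine_span L \<Longrightarrow> smooth p"
  by (induction rule: cosine_span.induct)
    (auto intro: smooth_add smooth_mult smooth_const smooth_cosine_wave)

lemma cosine_span_cmult: "p \<in> cosine_span L \<Longrightarrow> (\<lambda>x. c * p x) \<in> cosine_span L"
proof (induction rule: cosine_span.induct)
  case (wave d k)
  then show ?case using cosine_span.wave[of "c * d" L k] by (simp add: mult.assoc)
next
  case (add p q)
  then show ?case using cosine_span.add by (simp add: distrib_left)
qed

lemma cosine_span_second_partial_deriv:
  "p \<in> cosine_span L \<Longrightarrow> partial_deriv i (partial_deriv i p) \<in> cosine_span L"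
proof (induction rule: cosine_span.induct)
  case (wave c k)
  have "partial_deriv i (partial_deriv i (\<lambda>x. c * cosine_wave L k x)) =
     (\<lambda>x. (c * (- of_real ((pi * of_int (k $ i) / L $ i)\<^sup>2))) * cosine_wave L k x)"
    by (simp add: partial_deriv_cmult smooth_differentiable smooth_cosine_wave smooth_partial_deriv
        second_partial_deriv_cosine_wave mult.assoc)
  then show ?case by (simp only: cosine_span.wave)
next
  case (add p q)
  then show ?case
    using cosine_span.add
    by (simp add: partial_deriv_add smooth_differentiable smooth_partial_deriv smooth_cosine_span)
qed

lemma cosine_span_neumann:
  assumes "p \<in> cosine_span L" "L $ i > 0" "x $ i = 0 \<or> x $ i = L $ i"
  shows "partial_deriv i p x = 0"
  using assms(1)
  by (induction rule: cosine_span.induct)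
    (simp_all add: partial_deriv_cmult partial_deriv_add smooth_differentiable smooth_cosine_wave
      smooth_cosine_span cosine_wave_neumann assms(2,3))

text \<open>Stone--Weierstrass. The functions \<open>cos (\<pi> x\<^sub>i / L\<^sub>i)\<close> separate the points of the closed box, since
  the cosine is injective on \<open>[0, \<pi>]\<close>; on the whole torus the cosine waves would not separate points.\<close>

lemma cosine_span_dense:
  fixes L :: "real ^ 'n"
  assumes L: "\<And>i. L $ i > 0" and w: "continuous_on (cbox 0 L) w" and e: "e > 0"
  obtains q where "q \<in> cosine_span L" "\<And>x. x \<in> cbox 0 L \<Longrightarrow> norm (w x - q x) < e"
proof -
  \<comment> \<open>The multipliers of the span form an algebra, which contains the separating functions
    \<open>cos (\<pi> x\<^sub>i / L\<^sub>i)\<close>; they lie in the span themselves because it contains \<open>1\<close>.\<close>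
  define A where "A f \<longleftrightarrow> continuous_on (cbox 0 L) f \<and>
      (\<forall>q\<in>cosine_span L. (\<lambda>x. of_real (f x) * q x) \<in> cosine_span L)" for f :: "real ^ 'n \<Rightarrow> real"
  have A_const: "A (\<lambda>x. c)" for c
    by (auto simp: A_def intro: cosine_span_cmult)
  have A_add: "A (\<lambda>x. f x + g x)" if "A f \<and> A g" for f g
    using that by (auto simp: A_def distrib_right intro: continuous_on_add cosine_span.add)
  have A_mult: "A (\<lambda>x. f x * g x)" if "A f \<and> A g" for f g
    using that by (auto simp: A_def mult.assoc intro: continuous_on_mult)
  have A_cos: "A (\<lambda>x. cos (pi * x $ i / L $ i))" for i
    unfolding A_def
  proof (intro conjI ballI)
    show "continuous_on (cbox 0 L) (\<lambda>x. cos (pi * x $ i / L $ i))"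
      by (intro continuous_intros) (use L[of i] in auto)
    fix q assume "q \<in> cosine_span L"
    then show "(\<lambda>x. of_real (cos (pi * x $ i / L $ i)) * q x) \<in> cosine_span L"
    proof (induction rule: cosine_span.induct)
      case (wave c k)
      have "(\<lambda>x. of_real (cos (pi * x $ i / L $ i)) * (c * cosine_wave L k x)) =
         (\<lambda>x. c / 2 * cosine_wave L (k + axis i 1) x + c / 2 * cosine_wave L (k - axis i 1) x)"
        using cosine_wave_times_cos[of _ i L k] by (auto simp: algebra_simps fun_eq_iff)
      then show ?case by (simp only: cosine_span.intros)
    next
      case (add p q)
      then show ?case using cosine_span.add by (simp add: distrib_left)
    qed
  qed
  have A_sep: "\<exists>f. A f \<and> f x \<noteq> f y" if "x \<in> cbox 0 L \<and> y \<in> cbox 0 L \<and> x \<noteq> y" for x y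
  proof -
    have "\<exists>i. x $ i \<noteq> y $ i" using that by (metis vec_eq_iff)
    then obtain i where i: "x $ i \<noteq> y $ i" by blast
    have b: "0 \<le> pi * z $ i / L $ i \<and> pi * z $ i / L $ i \<le> pi" if "z \<in> cbox 0 L" for z
      using that L[of i] by (auto simp: mem_box_cart divide_simps)
    have "pi * x $ i / L $ i \<noteq> pi * y $ i / L $ i" using i L[of i] by auto
    then have "cos (pi * x $ i / L $ i) \<noteq> cos (pi * y $ i / L $ i)"
      using b cos_inj_pi that by blast
    then show ?thesis
      using A_cos[of i] by (intro exI[of _ "\<lambda>x. cos (pi * x $ i / L $ i)"] conjI)
  qed
  have real_dense: "\<exists>q\<in>cosine_span L. \<forall>x\<in>cbox 0 L. norm (of_real (f x) - q x) < e / 2"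
    if f: "continuous_on (cbox 0 L) f" for f
  proof -
    have "\<exists>g. A g \<and> (\<forall>x\<in>cbox 0 L. \<bar>f x - g x\<bar> < e / 2)"
      by (rule Stone_Weierstrass_HOL[where P=A and S="cbox 0 L"])
        (use A_const A_add A_mult A_sep f e in \<open>auto simp: A_def\<close>)
    then obtain g where g: "A g" "\<And>x. x \<in> cbox 0 L \<Longrightarrow> \<bar>f x - g x\<bar> < e / 2" by blast
    have one: "(\<lambda>x. 1) \<in> cosine_span L"
      using cosine_span.wave[of "1 / of_nat (card (sign_vectors :: (real ^ 'n) set))" L 0]
        cosine_wave_0(1)[of L] cosine_wave_0(2)[where 'n='n] by simp
    have "(\<lambda>x. of_real (g x)) \<in> cosine_span L"
      using g(1) one by (auto simp: A_def dest!: bspec[where x="\<lambda>x. 1"])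
    moreover have "norm (complex_of_real (f x) - of_real (g x)) < e / 2" if "x \<in> cbox 0 L" for x
      using g(2)[OF that] by (simp flip: of_real_diff)
    ultimately show ?thesis
      by (intro bexI[of _ "\<lambda>x. of_real (g x)"] ballI)
  qed
  obtain q1 where q1: "q1 \<in> cosine_span L" "\<And>x. x \<in> cbox 0 L \<Longrightarrow> norm (of_real (Re (w x)) - q1 x) < e / 2"
    using real_dense[OF continuous_on_Re[OF w]] by blast
  obtain q2 where q2: "q2 \<in> cosine_span L" "\<And>x. x \<in> cbox 0 L \<Longrightarrow> norm (of_real (Im (w x)) - q2 x) < e / 2"
    using real_dense[OF continuous_on_Im[OF w]] by blast
  show thesis
  proof (rule that[of "\<lambda>x. q1 x + \<i> * q2 x"])
    show "(\<lambda>x. q1 x + \<i> * q2 x) \<in> cosine_span L"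
      by (intro cosine_span.add cosine_span_cmult q1 q2)
    fix x assume x: "x \<in> cbox 0 L"
    have "w x - (q1 x + \<i> * q2 x) = (of_real (Re (w x)) - q1 x) + \<i> * (of_real (Im (w x)) - q2 x)"
      by (subst (1) complex_eq[of "w x"]) (simp add: algebra_simps)
    also have "norm \<dots> \<le> norm (of_real (Re (w x)) - q1 x) + norm (of_real (Im (w x)) - q2 x)"
      by (rule norm_triangle_le) (simp add: norm_mult)
    also have "\<dots> < e" using q1(2)[OF x] q2(2)[OF x] by simp
    finally show "norm (w x - (q1 x + \<i> * q2 x)) < e" .
  qed
qed

section \<open>A maximum principle under Neumann conditions\<close>

text \<open>The operator \<open>1 - \<partial>\<^sub>i\<^sup>2\<close>. Unlike \<open>\<partial>\<^sub>i\<^sup>2\<close> it is invertible on the span of all the cosine waves,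
  those constant in direction \<open>i\<close> included.\<close>

definition helmholtz :: "'n \<Rightarrow> (real ^ 'n \<Rightarrow> complex) \<Rightarrow> real ^ 'n \<Rightarrow> complex" where
  "helmholtz i v x = v x - partial_deriv i (partial_deriv i v) x"

lemma smooth_helmholtz: "smooth v \<Longrightarrow> smooth (helmholtz i v)"
  unfolding helmholtz_def[abs_def] by (intro smooth_diff smooth_partial_deriv)

lemma helmholtz_diff:
  assumes "smooth u" "smooth v"
  shows "helmholtz i (\<lambda>x. u x - v x) = (\<lambda>x. helmholtz i u x - helmholtz i v x)"
  using assms by (simp add: helmholtz_def[abs_def] partial_deriv_diff smooth_partial_deriv algebra_simps)

lemma helmholtz_commute_second_partial_deriv:
  assumes v: "smooth v"
  shows "helmholtz i (partial_deriv j (partial_deriv j v)) = partial_deriv j (partial_deriv j (helmholtz i v))"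
proof -
  note c = partial_deriv_commute[where i=i and j=j]
  have "partial_deriv i (partial_deriv i (partial_deriv j (partial_deriv j v))) =
      partial_deriv i (partial_deriv j (partial_deriv i (partial_deriv j v)))"
    by (simp only: c[OF smooth_partial_deriv[OF v]])
  also have "\<dots> = partial_deriv i (partial_deriv j (partial_deriv j (partial_deriv i v)))"
    by (simp only: c[OF v])
  also have "\<dots> = partial_deriv j (partial_deriv i (partial_deriv j (partial_deriv i v)))"
    by (rule c[OF smooth_partial_deriv[OF smooth_partial_deriv[OF v]]])
  also have "\<dots> = partial_deriv j (partial_deriv j (partial_deriv i (partial_deriv i v)))"
    by (simp only: c[OF smooth_partial_deriv[OF v]])
  finally show ?thesis
    by (simp add: helmholtz_def[abs_def] partial_deriv_diff smooth_partial_deriv v)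
qed

lemma helmholtz_commute:
  assumes "smooth v"
  shows "helmholtz i (helmholtz j v) = helmholtz j (helmholtz i v)"
proof -
  have "helmholtz i (helmholtz j v) = (\<lambda>x. helmholtz i v x - helmholtz i (partial_deriv j (partial_deriv j v)) x)"
    using helmholtz_diff[of v "partial_deriv j (partial_deriv j v)" i] assms
    by (simp add: smooth_partial_deriv helmholtz_def[of j v, abs_def])
  then show ?thesis
    using assms by (simp add: helmholtz_commute_second_partial_deriv helmholtz_def[of j "helmholtz i v", abs_def])
qed

primrec iter_helmholtz :: "'n list \<Rightarrow> (real ^ 'n \<Rightarrow> complex) \<Rightarrow> real ^ 'n \<Rightarrow> complex" where
  "iter_helmholtz [] v = v"
| "iter_helmholtz (i # is) v = helmholtz i (iter_helmholtz is v)"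

lemma smooth_iter_helmholtz: "smooth v \<Longrightarrow> smooth (iter_helmholtz is v)"
  by (induction "is") (auto intro: smooth_helmholtz)

lemma iter_helmholtz_append: "iter_helmholtz (is @ js) v = iter_helmholtz is (iter_helmholtz js v)"
  by (induction "is") auto

lemma iter_helmholtz_diff:
  assumes "smooth u" "smooth v"
  shows "iter_helmholtz is (\<lambda>x. u x - v x) = (\<lambda>x. iter_helmholtz is u x - iter_helmholtz is v x)"
  by (induction "is") (simp_all add: helmholtz_diff smooth_iter_helmholtz assms)

lemma iter_helmholtz_commute_second_partial_deriv:
  assumes "smooth v"
  shows "iter_helmholtz is (partial_deriv j (partial_deriv j v)) = partial_deriv j (partial_deriv j (iter_helmholtz is v))"
  by (induction "is") (simp_all add: helmholtz_commute_second_partial_deriv smooth_iter_helmholtz assms)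

lemma iter_helmholtz_commute:
  assumes "smooth v"
  shows "iter_helmholtz (is @ js) v = iter_helmholtz (js @ is) v"
proof -
  have one: "helmholtz i (iter_helmholtz js w) = iter_helmholtz js (helmholtz i w)" if "smooth w" for i js w
  proof (induction js)
    case (Cons j js)
    then show ?case
      using helmholtz_commute[OF smooth_iter_helmholtz[OF that], of i j js] by simp
  qed simp
  show ?thesis
  proof (induction "is")
    case (Cons i "is")
    have "iter_helmholtz ((i # is) @ js) v = helmholtz i (iter_helmholtz js (iter_helmholtz is v))"
      using Cons.IH by (simp add: iter_helmholtz_append)
    also have "\<dots> = iter_helmholtz (js @ (i # is)) v"
      using one[OF smooth_iter_helmholtz[OF assms]] by (simp add: iter_helmholtz_append)
    finally show ?case .
  qed simp
qed

lemma iter_partial_commute_partial_deriv: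
  assumes "smooth v"
  shows "iter_partial is (partial_deriv j v) = partial_deriv j (iter_partial is v)"
  by (induction "is") (simp_all add: partial_deriv_commute smooth_iter_partial assms)

text \<open>The errors made in approximating a test function by cosine waves, and all their images under
  the operators \<open>1 - \<partial>\<^sub>i\<^sup>2\<close>, belong to this space, and all its members satisfy the Neumann condition.\<close>

definition neumann_funs :: "real ^ 'n \<Rightarrow> (real ^ 'n \<Rightarrow> complex) set" where
  "neumann_funs L = {v. \<exists>\<phi>\<in>test_funs (box 0 L). \<exists>p\<in>cosine_span L. v = (\<lambda>x. \<phi> x + p x)}"

lemma neumann_funsI:
  "\<phi> \<in> test_funs (box 0 L) \<Longrightarrow> p \<in> cosine_span L \<Longrightarrow> (\<lambda>x. \<phi> x + p x) \<in> neumann_funs L"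
  by (auto simp: neumann_funs_def)

lemma smooth_neumann_funs: "v \<in> neumann_funs L \<Longrightarrow> smooth v"
  unfolding neumann_funs_def by (auto intro: smooth_add test_funs_smooth smooth_cosine_span)

lemma neumann_funs_second_partial_deriv:
  assumes "v \<in> neumann_funs L"
  shows "partial_deriv i (partial_deriv i v) \<in> neumann_funs L"
proof -
  obtain \<phi> p where *: "\<phi> \<in> test_funs (box 0 L)" "p \<in> cosine_span L" "v = (\<lambda>x. \<phi> x + p x)"
    using assms unfolding neumann_funs_def by blast
  have s: "smooth \<phi>" "smooth p"
    using * test_funs_smooth smooth_cosine_span by blast+
  have "partial_deriv i (partial_deriv i v) = (\<lambda>x. partial_deriv i (partial_deriv i \<phi>) x + partial_deriv i (partial_deriv i p) x)"
    by (simp add: *(3) partial_deriv_add smooth_differentiable smooth_partial_deriv s)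
  then show ?thesis
    unfolding neumann_funs_def
    using test_funs_partial_deriv[OF test_funs_partial_deriv[OF *(1)], of i i] cosine_span_second_partial_deriv[OF *(2), of i]
    by blast
qed

lemma neumann_funs_add_cmult:
  assumes "u \<in> neumann_funs L" "v \<in> neumann_funs L"
  shows "(\<lambda>x. u x + c * v x) \<in> neumann_funs L"
proof -
  obtain \<phi> p where *: "\<phi> \<in> test_funs (box 0 L)" "p \<in> cosine_span L" "u = (\<lambda>x. \<phi> x + p x)"
    using assms(1) unfolding neumann_funs_def by blast
  obtain \<psi> q where **: "\<psi> \<in> test_funs (box 0 L)" "q \<in> cosine_span L" "v = (\<lambda>x. \<psi> x + q x)"
    using assms(2) unfolding neumann_funs_def by blast
  have "(\<lambda>x. \<phi> x + c * \<psi> x) \<in> test_funs (box 0 L)"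
    using test_funs_add[OF *(1) test_funs_mult[OF **(1) smooth_const[of c]]] by (simp add: mult.commute)
  moreover have "(\<lambda>x. p x + c * q x) \<in> cosine_span L"
    by (intro cosine_span.add cosine_span_cmult * **)
  ultimately have "(\<lambda>x. (\<phi> x + c * \<psi> x) + (p x + c * q x)) \<in> neumann_funs L"
    by (rule neumann_funsI)
  then show ?thesis
    by (simp add: *(3) **(3) algebra_simps)
qed

lemma neumann_funs_helmholtz:
  assumes "v \<in> neumann_funs L"
  shows "helmholtz i v \<in> neumann_funs L"
  using neumann_funs_add_cmult[OF assms neumann_funs_second_partial_deriv[OF assms, of i], of "-1"]
  by (simp add: helmholtz_def[abs_def])

lemma neumann_funs_iter_helmholtz:
  "v \<in> neumann_funs L \<Longrightarrow> iter_helmholtz is v \<in> neumann_funs L"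
  by (induction "is") (auto intro: neumann_funs_helmholtz)

lemma neumann_funs_normal_derivative:
  fixes L :: "real ^ 'n"
  assumes "v \<in> neumann_funs L" "L $ i > 0" "x $ i = 0 \<or> x $ i = L $ i"
  shows "partial_deriv i v x = 0"
proof -
  obtain \<phi> p where *: "\<phi> \<in> test_funs (box 0 L)" "p \<in> cosine_span L" "v = (\<lambda>x. \<phi> x + p x)"
    using assms(1) unfolding neumann_funs_def by blast
  have s: "smooth \<phi>" "smooth p"
    using * test_funs_smooth smooth_cosine_span by blast+
  have "x \<notin> box 0 L" using assms(3) by (auto simp: mem_box_cart intro!: exI[of _ i])
  then have "partial_deriv i \<phi> x = 0"
    using test_funs_zero[OF test_funs_partial_deriv[OF *(1)]] by blast
  then show ?thesis
    using cosine_span_neumann[OF *(2) assms(2,3)]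
    by (simp add: *(3) partial_deriv_add smooth_differentiable s)
qed

text \<open>The second derivative test, also for a maximum at an end point of the interval, where the
  first derivative has to vanish by assumption. A positive second derivative would make the function
  increase away from \<open>0\<close>, and one side is always available.\<close>

lemma second_derivative_at_maximum:
  fixes g :: "real \<Rightarrow> real"
  assumes g: "\<And>t. (g has_real_derivative g' t) (at t)"
    and g': "(g' has_real_derivative D) (at 0)"
    and ab: "a \<le> 0" "0 \<le> b" "a < b"
    and max: "\<And>t. a \<le> t \<Longrightarrow> t \<le> b \<Longrightarrow> g t \<le> g 0"
    and crit: "a = 0 \<or> b = 0 \<Longrightarrow> g' 0 = 0"
  shows "D \<le> 0"
proof (rule ccontr)
  assume "\<not> D \<le> 0"
  then have D: "D > 0" by simp
  have g0: "g' 0 = 0"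
  proof (cases "a = 0 \<or> b = 0")
    case False
    then have "0 < min (- a) b" using ab by auto
    then show ?thesis
      by (rule DERIV_local_max[OF g]) (auto intro!: max)
  qed (rule crit)
  consider "b > 0" | "a < 0" using ab by linarith
  then show False
  proof cases
    case 1
    obtain d where d: "d > 0" "\<And>h. 0 < h \<Longrightarrow> h < d \<Longrightarrow> g' 0 < g' (0 + h)"
      using DERIV_pos_inc_right[OF g' D] by blast
    define s where "s = min b (d / 2)"
    have s: "0 < s" "s \<le> b" "s < d" using 1 d by (auto simp: s_def)
    obtain z where z: "0 < z" "z < s" "g s - g 0 = (s - 0) * g' z"
      using MVT2[of 0 s g g'] s g by blast
    have "g' z > 0" using d(2)[of z] z s g0 by simp
    then have "g s - g 0 > 0" using z s by simp
    moreover have "g s \<le> g 0" using max[of s] ab s by simp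
    ultimately show False by simp
  next
    case 2
    obtain d where d: "d > 0" "\<And>h. 0 < h \<Longrightarrow> h < d \<Longrightarrow> g' (0 - h) < g' 0"
      using DERIV_pos_inc_left[OF g' D] by blast
    define s where "s = min (- a) (d / 2)"
    have s: "0 < s" "s \<le> - a" "s < d" using 2 d by (auto simp: s_def)
    obtain z where z: "- s < z" "z < 0" "g 0 - g (- s) = (0 - (- s)) * g' z"
      using MVT2[of "- s" 0 g g'] s g by auto
    have "g' z < 0" using d(2)[of "- z"] z s g0 by simp
    then have "g 0 - g (- s) < 0" using z s by (simp add: mult_pos_neg)
    moreover have "g (- s) \<le> g 0" using max[of "- s"] ab s by simp
    ultimately show False by simp
  qed
qed

text \<open>At a maximum \<open>y\<close> of \<open>|v|\<close>, rotate so that \<open>v y = |v y|\<close>. Then \<open>Re v\<close> has a maximum at \<open>y\<close>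
  along direction \<open>i\<close>, so \<open>Re \<partial>\<^sub>i\<^sup>2 v \<le> 0\<close> at \<open>y\<close> and \<open>|v y| \<le> Re (v - \<partial>\<^sub>i\<^sup>2 v)\<close> there. The Neumann condition
  takes care of a maximum on the boundary.\<close>

lemma neumann_maximum_principle:
  fixes L :: "real ^ 'n"
  assumes L: "\<And>i. L $ i > 0" and v: "v \<in> neumann_funs L"
    and e: "\<And>x. x \<in> cbox 0 L \<Longrightarrow> norm (helmholtz i v x) \<le> e"
    and x: "x \<in> cbox 0 L"
  shows "norm (v x) \<le> e"
proof -
  have sv: "smooth v" by (rule smooth_neumann_funs[OF v])
  have "continuous_on (cbox 0 L) (\<lambda>x. norm (v x))"
    by (intro continuous_on_norm smooth_continuous_on sv)
  then obtain y where y: "y \<in> cbox 0 L" "\<And>z. z \<in> cbox 0 L \<Longrightarrow> norm (v z) \<le> norm (v y)"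
    using continuous_attains_sup[OF compact_cbox, of 0 L] x by (metis empty_iff)
  \<comment> \<open>The rotation by \<open>c\<close> turns \<open>v y\<close> into its modulus, so the real part of \<open>c v\<close> is also maximal at \<open>y\<close>.\<close>
  define c where "c = cnj (sgn (v y))"
  define r where "r z = Re (c * z)" for z
  have r: "bounded_linear r" unfolding r_def[abs_def]
    by (intro bounded_linear_compose[OF bounded_linear_Re] bounded_linear_mult_right)
  have r_le: "r z \<le> norm z" for z
  proof -
    have "norm c \<le> 1" by (simp add: c_def norm_sgn)
    then have "norm (c * z) \<le> norm z" by (simp add: norm_mult mult_left_le_one_le)
    then show ?thesis unfolding r_def using complex_Re_le_cmod[of "c * z"] by linarith
  qed
  have r_y: "r (v y) = norm (v y)"
  proof -
    have "c * v y = of_real (norm (v y))"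
      by (cases "v y = 0") (simp_all add: c_def sgn_eq complex_norm_square[symmetric] power2_eq_square mult.commute)
    then show ?thesis by (simp add: r_def)
  qed
  have line: "((\<lambda>t. r (u (y + t *\<^sub>R axis i 1))) has_real_derivative
      r (partial_deriv i u (y + t *\<^sub>R axis i 1))) (at t)" if "smooth u" for u t
    using bounded_linear.has_vector_derivative[OF r has_vector_derivative_line[OF that]]
    by (simp add: has_real_derivative_iff_has_vector_derivative)
  have yi: "0 \<le> y $ i" "y $ i \<le> L $ i" using y(1) by (auto simp: mem_box_cart)
  have D: "((\<lambda>t. r (partial_deriv i v (y + t *\<^sub>R axis i 1))) has_real_derivative
      r (partial_deriv i (partial_deriv i v) y)) (at 0)"
    using line[OF smooth_partial_deriv[OF sv], of i 0] by simp
  have "r (partial_deriv i (partial_deriv i v) y) \<le> 0"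
  proof (rule second_derivative_at_maximum[OF line[OF sv] D, of "- (y $ i)" "L $ i - y $ i"])
    fix t assume t: "- (y $ i) \<le> t" "t \<le> L $ i - y $ i"
    have "y + t *\<^sub>R axis i 1 \<in> cbox 0 L"
      using y(1) t by (auto simp: mem_box_cart axis_def)
    then show "r (v (y + t *\<^sub>R axis i 1)) \<le> r (v (y + 0 *\<^sub>R axis i 1))"
      using y(2) r_le[of "v (y + t *\<^sub>R axis i 1)"] r_y by (simp add: order_trans)
  next
    assume "- (y $ i) = 0 \<or> L $ i - y $ i = 0"
    then have "partial_deriv i v y = 0"
      by (intro neumann_funs_normal_derivative[OF v L]) auto
    then show "r (partial_deriv i v (y + 0 *\<^sub>R axis i 1)) = 0" by (simp add: r_def)
  qed (use yi L[of i] in auto)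
  then have "norm (v y) \<le> r (v y) - r (partial_deriv i (partial_deriv i v) y)"
    using r_y by simp
  also have "\<dots> = r (helmholtz i v y)"
    by (simp add: helmholtz_def r_def right_diff_distrib)
  also have "\<dots> \<le> e" using r_le e[OF y(1)] order_trans by blast
  finally show ?thesis using y(2)[OF x] by linarith
qed

section \<open>Approximation of test functions by cosine waves\<close>

text \<open>Derivatives of odd order are recovered from the neighbouring even orders, up to the
  boundary, since the whole segment through \<open>x\<close> in direction \<open>i\<close> has length \<open>L\<^sub>i\<close>.\<close>

lemma landau_inequality_on_box:
  fixes L :: "real ^ 'n"
  assumes L: "L $ i > 0" and v: "smooth v"
    and a: "\<And>x. x \<in> cbox 0 L \<Longrightarrow> norm (v x) \<le> a"
    and b: "\<And>x. x \<in> cbox 0 L \<Longrightarrow> norm (partial_deriv i (partial_deriv i v) x) \<le> b"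
    and x: "x \<in> cbox 0 L"
  shows "norm (partial_deriv i v x) \<le> 2 * a / L $ i + 2 * b * L $ i"
proof -
  define l where "l = L $ i"
  have l: "l > 0" using L by (simp add: l_def)
  define y where "y = x - x $ i *\<^sub>R axis i 1"
  define s where "s = x $ i"
  have xy: "x = y + s *\<^sub>R axis i 1" by (simp add: y_def s_def)
  have s: "s \<in> {0..l}" using x by (auto simp: s_def l_def mem_box_cart)
  have Q: "y + t *\<^sub>R axis i 1 \<in> cbox 0 L" if "t \<in> {0..l}" for t
    using x that by (auto simp: mem_box_cart axis_def y_def l_def)
  define g where "g t = v (y + t *\<^sub>R axis i 1)" for t
  define g' where "g' t = partial_deriv i v (y + t *\<^sub>R axis i 1)" for t
  define g'' where "g'' t = partial_deriv i (partial_deriv i v) (y + t *\<^sub>R axis i 1)" for t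
  have dg: "(g has_vector_derivative g' t) (at t within {0..l})" for t
    unfolding g_def[abs_def] g'_def by (rule has_vector_derivative_line[OF v])
  have dg': "(g' has_vector_derivative g'' t) (at t within {0..l})" for t
    unfolding g'_def[abs_def] g''_def by (rule has_vector_derivative_line[OF smooth_partial_deriv[OF v]])
  \<comment> \<open>The derivative \<open>g'\<close> varies by at most \<open>b l\<close> on the segment, so \<open>l g'(s)\<close> differs from
    \<open>g l - g 0\<close> by at most \<open>b l\<^sup>2\<close>.\<close>
  have "norm (g' t - g' s) \<le> b * l" if t: "t \<in> {0..l}" for t
  proof -
    have "norm (g' t - g' s) \<le> b * norm (t - s)"
    proof (rule differentiable_bound[of "{0..l}" g' "\<lambda>t h. h *\<^sub>R g'' t"])
      show "(g' has_derivative (\<lambda>h. h *\<^sub>R g'' t)) (at t within {0..l})" for t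
        using dg' by (simp add: has_vector_derivative_def)
      show "onorm (\<lambda>h. h *\<^sub>R g'' t) \<le> b" if "t \<in> {0..l}" for t
        using b[OF Q[OF that]]
        by (intro onorm_le) (simp add: g''_def mult.commute[of b] mult_left_mono)
    qed (use s t in auto)
    also have "\<dots> \<le> b * l"
    proof (rule mult_left_mono)
      show "norm (t - s) \<le> l" using s t by auto
      show "0 \<le> b" using b[OF x] norm_ge_zero order_trans by blast
    qed
    finally show ?thesis .
  qed
  then have "norm (g l - g 0 - (l - 0) *\<^sub>R g' s) \<le> norm (l - 0) * (b * l)"
    using s l by (intro vector_differentiable_bound_linearization[OF dg]) (auto simp: closed_segment_eq_real_ivl)
  then have *: "norm (g l - g 0 - l *\<^sub>R g' s) \<le> l * (b * l)" using l by simp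
  have "norm (l *\<^sub>R g' s) \<le> norm (g l) + norm (g 0) + norm (g l - g 0 - l *\<^sub>R g' s)"
    using norm_triangle_ineq4[of "g l - g 0" "g l - g 0 - l *\<^sub>R g' s"] norm_triangle_ineq4[of "g l" "g 0"]
    by simp
  also have "\<dots> \<le> a + a + l * (b * l)"
    using * a[OF Q, of l] a[OF Q, of 0] l by (intro add_mono) (auto simp: g_def)
  finally have "l * norm (g' s) \<le> 2 * a + l * (b * l)" using l by simp
  then have "norm (g' s) \<le> (2 * a + l * (b * l)) / l"
    using l by (simp add: field_simps)
  also have "\<dots> = 2 * a / l + b * l" using l by (simp add: field_simps)
  also have "\<dots> \<le> 2 * a / l + 2 * b * l"
  proof -
    have "0 \<le> b" using b[OF x] norm_ge_zero order_trans by blast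
    then show ?thesis using l by simp
  qed
  finally show ?thesis by (simp add: g'_def l_def xy)
qed

text \<open>A priori estimate: one operator \<open>1 - \<partial>\<^sub>i\<^sup>2\<close> for each derivative \<open>\<partial>\<^sub>i\<close>. In the induction step \<open>\<partial>\<^sub>i v\<close>
  leaves the space of Neumann functions, but \<open>\<partial>\<^sub>i\<^sup>2 v\<close> does not; commuting it to the inside gives
  bounds on \<open>w = \<partial>\<^bsup>is\<^esup> v\<close> and \<open>\<partial>\<^sub>i\<^sup>2 w\<close>, and Landau's inequality gives one on \<open>\<partial>\<^sub>i w\<close>.\<close>

lemma iter_partial_bounded_by_iter_helmholtz:
  fixes L :: "real ^ 'n"
  assumes L: "\<And>i. L $ i > 0"
  shows "\<exists>C\<ge>0. \<forall>v e. v \<in> neumann_funs L \<and> (\<forall>x\<in>cbox 0 L. norm (iter_helmholtz is v x) \<le> e)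
    \<longrightarrow> (\<forall>x\<in>cbox 0 L. norm (iter_partial is v x) \<le> C * e)"
proof (induction "is")
  case Nil
  show ?case by (rule exI[of _ 1]) simp
next
  case (Cons i "is")
  obtain C where C: "C \<ge> 0" "\<And>v e x. v \<in> neumann_funs L \<Longrightarrow>
      (\<And>x. x \<in> cbox 0 L \<Longrightarrow> norm (iter_helmholtz is v x) \<le> e) \<Longrightarrow> x \<in> cbox 0 L \<Longrightarrow>
      norm (iter_partial is v x) \<le> C * e"
    using Cons.IH by metis
  define K where "K = 2 * C / L $ i + 2 * (C * 2) * L $ i"
  show ?case
  proof (intro exI[of _ K] conjI allI impI ballI)
    show "K \<ge> 0" using C(1) L[of i] by (simp add: K_def)
    fix v e x
    assume *: "v \<in> neumann_funs L \<and> (\<forall>x\<in>cbox 0 L. norm (iter_helmholtz (i # is) v x) \<le> e)"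
      and x: "x \<in> cbox 0 L"
    then have v: "v \<in> neumann_funs L" and h: "\<And>x. x \<in> cbox 0 L \<Longrightarrow> norm (helmholtz i (iter_helmholtz is v) x) \<le> e"
      by auto
    have sv: "smooth v" by (rule smooth_neumann_funs[OF v])
    have h0: "norm (iter_helmholtz is v x) \<le> e" if "x \<in> cbox 0 L" for x
      by (rule neumann_maximum_principle[OF L neumann_funs_iter_helmholtz[OF v] h that])
    have h2: "norm (iter_helmholtz is (partial_deriv i (partial_deriv i v)) x) \<le> 2 * e" if "x \<in> cbox 0 L" for x
    proof -
      \<comment> \<open>\<open>\<partial>\<^sub>i\<^sup>2 = 1 - (1 - \<partial>\<^sub>i\<^sup>2)\<close>, applied to the function that is already controlled.\<close>
      have "iter_helmholtz is (partial_deriv i (partial_deriv i v)) x =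
          iter_helmholtz is v x - helmholtz i (iter_helmholtz is v) x"
        by (simp add: iter_helmholtz_commute_second_partial_deriv[OF sv] helmholtz_def)
      then show ?thesis
        using norm_triangle_ineq4[of "iter_helmholtz is v x" "helmholtz i (iter_helmholtz is v) x"]
          h0[OF that] h[OF that] by simp
    qed
    have b0: "norm (iter_partial is v x) \<le> C * e" if "x \<in> cbox 0 L" for x
      using C(2)[OF v h0 that] .
    have b2: "norm (partial_deriv i (partial_deriv i (iter_partial is v)) x) \<le> C * (2 * e)" if "x \<in> cbox 0 L" for x
      using C(2)[OF neumann_funs_second_partial_deriv[OF v] h2 that]
      by (simp add: iter_partial_commute_partial_deriv sv smooth_partial_deriv)
    have "norm (partial_deriv i (iter_partial is v) x) \<le> 2 * (C * e) / L $ i + 2 * (C * (2 * e)) * L $ i"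
      by (rule landau_inequality_on_box[OF L smooth_iter_partial[OF sv] b0 b2 x])
    also have "\<dots> = K * e" by (simp add: K_def algebra_simps)
    finally show "norm (iter_partial (i # is) v x) \<le> K * e" by simp
  qed
qed

text \<open>Operators on the left are removed by the maximum principle, those on the right after commuting
  them to the left.\<close>

lemma iter_helmholtz_bound_sublist:
  fixes L :: "real ^ 'n"
  assumes L: "\<And>i. L $ i > 0" and v: "v \<in> neumann_funs L"
    and e: "\<And>x. x \<in> cbox 0 L \<Longrightarrow> norm (iter_helmholtz (is @ js @ ks) v x) \<le> e"
    and x: "x \<in> cbox 0 L"
  shows "norm (iter_helmholtz js v x) \<le> e"
proof -
  have drop: "\<forall>x\<in>cbox 0 L. norm (iter_helmholtz ms v x) \<le> e"
    if "\<forall>x\<in>cbox 0 L. norm (iter_helmholtz (ls @ ms) v x) \<le> e" for ls ms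
    using that
  proof (induction ls)
    case (Cons i ls)
    have "norm (iter_helmholtz (ls @ ms) v x) \<le> e" if "x \<in> cbox 0 L" for x
      by (rule neumann_maximum_principle[OF L neumann_funs_iter_helmholtz[OF v] _ that]) (use Cons.prems in auto)
    then show ?case using Cons.IH by blast
  qed simp
  have "\<forall>x\<in>cbox 0 L. norm (iter_helmholtz (js @ ks) v x) \<le> e"
    using drop[of "is" "js @ ks"] e by blast
  then have "\<forall>x\<in>cbox 0 L. norm (iter_helmholtz (ks @ js) v x) \<le> e"
    by (simp only: iter_helmholtz_commute[OF smooth_neumann_funs[OF v], of js ks])
  then show ?thesis using drop x by blast
qed

lemma helmholtz_surj_cosine_span:
  assumes "q \<in> cosine_span L"
  shows "\<exists>p\<in>cosine_span L. helmholtz i p = q"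
  using assms
proof (induction rule: cosine_span.induct)
  case (wave c k)
  \<comment> \<open>\<open>s\<close> is the eigenvalue of the operator on the wave; it is at least \<open>1\<close>.\<close>
  define s where "s = complex_of_real (1 + (pi * of_int (k $ i) / L $ i)\<^sup>2)"
  have "1 + (pi * of_int (k $ i) / L $ i)\<^sup>2 > 0" by (smt (verit) zero_le_power2)
  then have s: "s \<noteq> 0" unfolding s_def of_real_eq_0_iff by simp
  have "partial_deriv i (partial_deriv i (\<lambda>x. d * cosine_wave L k x)) =
      (\<lambda>x. d * partial_deriv i (partial_deriv i (cosine_wave L k)) x)" for d
    by (simp only: partial_deriv_cmult smooth_differentiable smooth_cosine_wave smooth_partial_deriv)
  then have "helmholtz i (\<lambda>x. c / s * cosine_wave L k x) = (\<lambda>x. c / s * (s * cosine_wave L k x))"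
    by (simp only: helmholtz_def[abs_def] second_partial_deriv_cosine_wave s_def)
      (simp add: algebra_simps)
  also have "\<dots> = (\<lambda>x. c * cosine_wave L k x)" using s by simp
  finally show ?case using cosine_span.wave by blast
next
  case (add p q)
  then obtain p' q' where *: "p' \<in> cosine_span L" "helmholtz i p' = p" "q' \<in> cosine_span L" "helmholtz i q' = q"
    by blast
  have "helmholtz i (\<lambda>x. p' x + q' x) = (\<lambda>x. helmholtz i p' x + helmholtz i q' x)"
    using smooth_cosine_span[OF *(1)] smooth_cosine_span[OF *(3)]
    by (simp add: helmholtz_def[abs_def] partial_deriv_add smooth_differentiable smooth_partial_deriv
        algebra_simps)
  then show ?case using * cosine_span.add by metis
qed

lemma iter_helmholtz_surj_cosine_span:
  "q \<in> cosine_span L \<Longrightarrow> \<exists>p\<in>cosine_span L. iter_helmholtz is p = q"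
proof (induction "is" arbitrary: q)
  case (Cons i "is")
  then show ?case using helmholtz_surj_cosine_span[of q L i] by fastforce
qed auto

text \<open>Density of the cosine waves in the \<open>C\<^sup>N\<close> topology. Let \<open>B\<close> be a product of operators \<open>1 - \<partial>\<^sub>i\<^sup>2\<close>
  that dominates all the derivatives up to order \<open>N\<close>. Approximate \<open>B \<phi>\<close> uniformly by \<open>q\<close> in the
  span and set \<open>p = B\<^sup>-\<^sup>1 q\<close>: the a priori estimate bounds the derivatives of \<open>\<phi> - p\<close> by
  \<open>B \<phi> - q\<close>.\<close>

lemma test_funs_approximation:
  fixes L :: "real ^ 'n"
  assumes L: "\<And>i. L $ i > 0" and \<phi>: "\<phi> \<in> test_funs (box 0 L)" and e: "e > 0"
  obtains p where "p \<in> cosine_span L"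
    "\<And>is x. length is \<le> N \<Longrightarrow> x \<in> cbox 0 L \<Longrightarrow> norm (iter_partial is (\<lambda>x. \<phi> x - p x) x) \<le> e"
proof -
  obtain C where C: "\<And>is. C is \<ge> 0" "\<And>is v e x. v \<in> neumann_funs L \<Longrightarrow>
      (\<And>x. x \<in> cbox 0 L \<Longrightarrow> norm (iter_helmholtz is v x) \<le> e) \<Longrightarrow> x \<in> cbox 0 L \<Longrightarrow>
      norm (iter_partial is v x) \<le> C is * e"
    using iter_partial_bounded_by_iter_helmholtz[OF L] by metis
  have fin: "finite {is :: 'n list. length is \<le> N}"
    using finite_lists_length_le[of "UNIV :: 'n set" N] by simp
  \<comment> \<open>One composite operator, built from the concatenation of all index lists of length at most \<open>N\<close>,
    controls all the derivatives at once.\<close>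
  obtain ls where ls: "set ls = {is :: 'n list. length is \<le> N}" using finite_list[OF fin] by blast
  define B where "B = (\<Sum>is | length is \<le> N. C is) + 1"
  have B1: "B > 0" unfolding B_def using C(1) by (simp add: add_nonneg_pos sum_nonneg)
  have BC: "C is \<le> B" if "length is \<le> N" for "is"
    using member_le_sum[of "is" "{is. length is \<le> N}" C] fin that C(1) by (simp add: B_def)
  have s\<phi>: "smooth \<phi>" by (rule test_funs_smooth[OF \<phi>])
  obtain q where q: "q \<in> cosine_span L"
    "\<And>x. x \<in> cbox 0 L \<Longrightarrow> norm (iter_helmholtz (concat ls) \<phi> x - q x) < e / B"
    using cosine_span_dense[OF L smooth_continuous_on[OF smooth_iter_helmholtz[OF s\<phi>]], of "e / B"] e B1
    by (metis divide_pos_pos)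
  obtain p where p: "p \<in> cosine_span L" "iter_helmholtz (concat ls) p = q"
    using iter_helmholtz_surj_cosine_span[OF q(1)] by blast
  define u where "u = (\<lambda>x. \<phi> x - p x)"
  have u: "u \<in> neumann_funs L"
    using neumann_funsI[OF \<phi> cosine_span_cmult[OF p(1), of "-1"]] by (simp add: u_def)
  have hu: "norm (iter_helmholtz (concat ls) u x) \<le> e / B" if "x \<in> cbox 0 L" for x
    using q(2)[OF that] p(2)
    by (simp add: u_def iter_helmholtz_diff[OF s\<phi> smooth_cosine_span[OF p(1)]] less_imp_le)
  show thesis
  proof (rule that[OF p(1)])
    fix "is" :: "'n list" and x assume len: "length is \<le> N" and x: "x \<in> cbox 0 L"
    then have "is \<in> set ls" using ls by simp
    then obtain as bs where "ls = as @ is # bs" by (meson split_list)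
    then have cc: "concat ls = concat as @ is @ concat bs" by simp
    have "norm (iter_helmholtz is u y) \<le> e / B" if "y \<in> cbox 0 L" for y
      by (rule iter_helmholtz_bound_sublist[OF L u hu[unfolded cc] that])
    then have "norm (iter_partial is u x) \<le> C is * (e / B)"
      using C(2)[OF u _ x] by blast
    also have "\<dots> \<le> B * (e / B)"
      using BC[OF len] e B1 by (intro mult_right_mono) auto
    also have "\<dots> = e" using B1 by simp
    finally show "norm (iter_partial is (\<lambda>x. \<phi> x - p x) x) \<le> e" by (simp add: u_def)
  qed
qed

section \<open>Billiard integrals of plane waves\<close>

lemma cosine_wave_eq_fold_sum:
  fixes L :: "real ^ 'n"
  assumes "\<And>i. L $ i > 0"
  shows "(\<Sum>\<epsilon> | \<forall>i. \<epsilon> $ i \<in> {-1, 1 :: real}.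
      plane_wave ((2 * pi) *\<^sub>R int_vec k) (\<chi> i. \<epsilon> $ i * x $ i / (2 * L $ i))) = cosine_wave L k x"
proof -
  have "((2 * pi) *\<^sub>R int_vec k) \<bullet> (\<chi> i. \<epsilon> $ i * x $ i / (2 * L $ i)) = wave_vector L k \<epsilon> \<bullet> x" for \<epsilon>
    using assms unfolding inner_vec_def
    by (intro sum.cong refl) (simp add: int_vec_def wave_vector_def field_simps)
  then show ?thesis
    by (simp add: cosine_wave_def plane_wave_def sign_vectors_def)
qed

lemma torus_plane_wave: "plane_wave ((2 * pi) *\<^sub>R int_vec k) \<in> torus_test_funs"
proof -
  have "plane_wave ((2 * pi) *\<^sub>R int_vec k) (x + int_vec m) = plane_wave ((2 * pi) *\<^sub>R int_vec k) x" for x m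
  proof -
    have "((2 * pi) *\<^sub>R int_vec k) \<bullet> int_vec m = 2 * pi * of_int (\<Sum>i\<in>UNIV. k $ i * m $ i)"
      by (simp add: inner_vec_def int_vec_def sum_distrib_left mult.assoc)
    then have "cis (((2 * pi) *\<^sub>R int_vec k) \<bullet> int_vec m) = 1"
      by (simp only:) (rule cis_multiple_2pi[OF Ints_of_int])
    then show ?thesis
      by (simp add: plane_wave_def inner_add_right flip: cis_mult)
  qed
  then show ?thesis by (simp add: torus_test_funs_def smooth_plane_wave)
qed

lemma torus_xray_plane_wave:
  assumes "a \<bullet> int_vec v = 0"
  shows "torus_xray (plane_wave a) v = plane_wave a"
  using assms by (simp add: torus_xray_def[abs_def] plane_wave_def[abs_def] inner_add_right)

text \<open>Take \<open>k\<^sub>i e\<^sub>j - k\<^sub>j e\<^sub>i\<close> if \<open>k\<^sub>i \<noteq> 0\<close>, and \<open>e\<^sub>i\<close> otherwise. In dimension one only \<open>k = 0\<close> has such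
  a \<open>v\<close>.\<close>

lemma orthogonal_int_vec_exists:
  fixes k :: "int ^ 'n"
  assumes "CARD('n) \<ge> 2"
  obtains v :: "int ^ 'n" where "v \<noteq> 0" "int_vec k \<bullet> int_vec v = 0"
proof -
  obtain i j :: 'n where ij: "i \<noteq> j"
    using assms card_le_Suc0_iff_eq[of "UNIV :: 'n set"] by fastforce
  show thesis
  proof (cases "k $ i = 0")
    case True
    have "axis i 1 \<noteq> (0 :: int ^ 'n)" by (simp add: axis_eq_0_iff)
    moreover have "int_vec k \<bullet> int_vec (axis i 1) = 0"
      using True by (auto simp: inner_vec_def int_vec_def axis_def intro!: sum.neutral)
    ultimately show ?thesis by (rule that)
  next
    case False
    define v :: "int ^ 'n" where "v = (\<chi> l. if l = i then - k $ j else if l = j then k $ i else 0)"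
    have "v $ j \<noteq> 0" using False ij by (simp add: v_def)
    then have "v \<noteq> 0" by auto
    moreover have "int_vec k \<bullet> int_vec v = 0"
    proof -
      have "int_vec k \<bullet> int_vec v = (\<Sum>l\<in>UNIV. real_of_int (k $ l * v $ l))"
        by (simp add: inner_vec_def int_vec_def)
      also have "\<dots> = (\<Sum>l\<in>{i, j}. real_of_int (k $ l * v $ l))"
        by (rule sum.mono_neutral_right) (auto simp: v_def)
      also have "\<dots> = 0" using ij by (simp add: v_def)
      finally show ?thesis .
    qed
    ultimately show ?thesis by (rule that)
  qed
qed

lemma billiard_integrals_plane_wave:
  fixes L :: "real ^ 'n"
  assumes "\<And>i. L $ i > 0" "int_vec k \<bullet> int_vec v = 0"
  shows "billiard_integrals L f1 f2 v (plane_wave ((2 * pi) *\<^sub>R int_vec k)) =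
    of_real (\<Prod>i\<in>UNIV. 1 / (2 * L $ i)) * sum_pairing (billiard_box L) f1 f2 (cosine_wave L k)"
proof -
  have "torus_xray (plane_wave ((2 * pi) *\<^sub>R int_vec k)) v = plane_wave ((2 * pi) *\<^sub>R int_vec k)"
    by (rule torus_xray_plane_wave) (simp add: assms)
  then show ?thesis
    by (simp add: billiard_integrals_def torus_xray_dist_def fold_pullback_def
        cosine_wave_eq_fold_sum[OF assms(1)] del: insert_iff)
qed

section \<open>Sums of integrable functions and distributions\<close>

text \<open>The chosen cutoff exists because the support is a compact subset of the box.\<close>

lemma smooth_action_cutoff:
  fixes L :: "real ^ 'n"
  assumes "compactly_supported_distribution_on (box 0 L) u"
  obtains \<kappa> where "\<kappa> \<in> test_funs (box 0 L)"
    "\<And>\<phi>. smooth_action (box 0 L) u \<phi> = u (\<lambda>x. \<kappa> x * \<phi> x)"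
proof -
  have "compact (dist_supp (box 0 L) u)" "dist_supp (box 0 L) u \<subseteq> box 0 L"
    using assms by (auto simp: compactly_supported_distribution_on_def dist_supp_def)
  then obtain \<theta> V where \<theta>: "(\<lambda>x. complex_of_real (\<theta> x)) \<in> test_funs (box 0 L)"
    "\<And>x. 0 \<le> \<theta> x" "\<And>x. \<theta> x \<le> 1" "open V" "dist_supp (box 0 L) u \<subseteq> V" "\<And>x. x \<in> V \<Longrightarrow> \<theta> x = 1"
    by (rule smooth_cutoff_exists) (rule that)
  then have "cutoff_for (box 0 L) u (\<lambda>x. complex_of_real (\<theta> x))"
    by (auto simp: cutoff_for_def intro!: exI[of _ V])
  then have "cutoff_for (box 0 L) u (SOME \<kappa>. cutoff_for (box 0 L) u \<kappa>)"
    by (rule someI[where P="cutoff_for (box 0 L) u"])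
  then show thesis
    by (intro that[of "SOME \<kappa>. cutoff_for (box 0 L) u \<kappa>"])
      (simp_all add: cutoff_for_def smooth_action_def Let_def)
qed

lemma set_integrable_times_continuous:
  fixes f \<phi> :: "real ^ 'n \<Rightarrow> complex"
  assumes "f absolutely_integrable_on cbox a b" "continuous_on (cbox a b) \<phi>"
  shows "(\<lambda>x. f x * \<phi> x) absolutely_integrable_on cbox a b"
proof -
  have "(\<lambda>x. \<phi> x * f x) absolutely_integrable_on cbox a b"
  proof (rule absolutely_integrable_bounded_measurable_product[OF bilinear_times _ _ _ assms(1)])
    show "\<phi> \<in> borel_measurable (lebesgue_on (cbox a b))"
      using assms(2) by (rule continuous_imp_measurable_on_sets_lebesgue) simp
    show "bounded (\<phi> ` cbox a b)"
      by (intro compact_imp_bounded compact_continuous_image assms(2) compact_cbox)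
  qed simp
  then show ?thesis by (simp add: mult.commute)
qed

lemma distribution_on_linear:
  assumes "distribution_on U u" "\<phi> \<in> test_funs U" "\<psi> \<in> test_funs U"
  shows "u (\<lambda>x. a * \<phi> x + b * \<psi> x) = a * u \<phi> + b * u \<psi>"
  using assms unfolding distribution_on_def by blast

lemma sum_pairing_linear:
  fixes L :: "real ^ 'n"
  assumes f1: "f1 absolutely_integrable_on cbox 0 L"
    and f2: "compactly_supported_distribution_on (box 0 L) f2"
    and \<phi>: "smooth \<phi>" and \<psi>: "smooth \<psi>"
  shows "sum_pairing (cbox 0 L) f1 f2 (\<lambda>x. a * \<phi> x + b * \<psi> x) =
    a * sum_pairing (cbox 0 L) f1 f2 \<phi> + b * sum_pairing (cbox 0 L) f1 f2 \<psi>"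
proof -
  obtain \<kappa> where \<kappa>: "\<kappa> \<in> test_funs (box 0 L)"
    "\<And>\<phi>. smooth_action (box 0 L) f2 \<phi> = f2 (\<lambda>x. \<kappa> x * \<phi> x)"
    using smooth_action_cutoff[OF f2] by blast
  have "distribution_on (box 0 L) f2"
    using f2 by (simp add: compactly_supported_distribution_on_def)
  from distribution_on_linear[OF this test_funs_mult[OF \<kappa>(1) \<phi>] test_funs_mult[OF \<kappa>(1) \<psi>]]
  have 1: "smooth_action (box 0 L) f2 (\<lambda>x. a * \<phi> x + b * \<psi> x) =
      a * smooth_action (box 0 L) f2 \<phi> + b * smooth_action (box 0 L) f2 \<psi>"
    by (simp add: \<kappa>(2) algebra_simps)
  have i: "(\<lambda>x. f1 x * \<phi> x) absolutely_integrable_on cbox 0 L" "(\<lambda>x. f1 x * \<psi> x) absolutely_integrable_on cbox 0 L"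
    by (intro set_integrable_times_continuous f1 smooth_continuous_on \<phi> \<psi>)+
  have "(LINT x:cbox 0 L|lebesgue. f1 x * (a * \<phi> x + b * \<psi> x)) =
      (LINT x:cbox 0 L|lebesgue. a * (f1 x * \<phi> x) + b * (f1 x * \<psi> x))"
    by (simp add: algebra_simps)
  also have "\<dots> = a * (LINT x:cbox 0 L|lebesgue. f1 x * \<phi> x) + b * (LINT x:cbox 0 L|lebesgue. f1 x * \<psi> x)"
    using i by (subst set_integral_add) auto
  finally show ?thesis
    by (simp add: sum_pairing_def interior_cbox 1 distrib_left)
qed

lemma sum_pairing_bound:
  fixes L :: "real ^ 'n"
  assumes f1: "f1 absolutely_integrable_on cbox 0 L"
    and f2: "compactly_supported_distribution_on (box 0 L) f2"
  shows "\<exists>C N. C \<ge> 0 \<and> (\<forall>\<phi> e. smooth \<phi> \<and> e \<ge> 0 \<and>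
      (\<forall>is x. length is \<le> N \<and> x \<in> cbox 0 L \<longrightarrow> norm (iter_partial is \<phi> x) \<le> e) \<longrightarrow>
      norm (sum_pairing (cbox 0 L) f1 f2 \<phi>) \<le> C * e)"
proof -
  obtain \<kappa> where \<kappa>: "\<kappa> \<in> test_funs (box 0 L)"
    "\<And>\<phi>. smooth_action (box 0 L) f2 \<phi> = f2 (\<lambda>x. \<kappa> x * \<phi> x)"
    using smooth_action_cutoff[OF f2] by blast
  have "distribution_on (box 0 L) f2"
    using f2 by (simp add: compactly_supported_distribution_on_def)
  from distribution_cutoff_bound[OF this \<kappa>(1)] obtain C N where CN: "C \<ge> 0"
    "\<And>\<phi> e. smooth \<phi> \<Longrightarrow> e \<ge> 0 \<Longrightarrow>
      (\<And>is x. length is \<le> N \<Longrightarrow> x \<in> box 0 L \<Longrightarrow> norm (iter_partial is \<phi> x) \<le> e) \<Longrightarrow>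
      norm (f2 (\<lambda>x. \<kappa> x * \<phi> x)) \<le> C * e"
    by metis
  define I where "I = (LINT x:cbox 0 L|lebesgue. norm (f1 x))"
  have I: "set_integrable lebesgue (cbox 0 L) (\<lambda>x. norm (f1 x))"
    using set_integrable_norm[OF f1] .
  have I0: "I \<ge> 0" unfolding I_def set_lebesgue_integral_def by (rule Bochner_Integration.integral_nonneg) auto
  show ?thesis
  proof (intro exI[of _ "I + C"] exI[of _ N] conjI allI impI)
    show "I + C \<ge> 0" using I0 CN(1) by simp
    fix \<phi> e
    assume "smooth \<phi> \<and> e \<ge> 0 \<and> (\<forall>is x. length is \<le> N \<and> x \<in> cbox 0 L \<longrightarrow> norm (iter_partial is \<phi> x) \<le> e)"
    then have \<phi>: "smooth \<phi>" and e: "e \<ge> 0"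
      and b: "\<And>is x. length is \<le> N \<Longrightarrow> x \<in> cbox 0 L \<Longrightarrow> norm (iter_partial is \<phi> x) \<le> e" by auto
    have b0: "norm (\<phi> x) \<le> e" if "x \<in> cbox 0 L" for x using b[of "[]" x] that by simp
    have i: "(\<lambda>x. f1 x * \<phi> x) absolutely_integrable_on cbox 0 L"
      by (intro set_integrable_times_continuous f1 smooth_continuous_on \<phi>)
    have "norm (LINT x:cbox 0 L|lebesgue. f1 x * \<phi> x) \<le> (LINT x:cbox 0 L|lebesgue. norm (f1 x * \<phi> x))"
      by (rule set_integral_norm_bound[OF i])
    also have "\<dots> \<le> (LINT x:cbox 0 L|lebesgue. norm (f1 x) * e)"
    proof (rule set_integral_mono)
      show "set_integrable lebesgue (cbox 0 L) (\<lambda>x. norm (f1 x * \<phi> x))" by (rule set_integrable_norm[OF i])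
      show "set_integrable lebesgue (cbox 0 L) (\<lambda>x. norm (f1 x) * e)" using I by simp
      show "norm (f1 x * \<phi> x) \<le> norm (f1 x) * e" if "x \<in> cbox 0 L" for x
        using b0[OF that] by (simp add: norm_mult mult_left_mono)
    qed
    also have "\<dots> = I * e" by (simp add: I_def)
    finally have 1: "norm (LINT x:cbox 0 L|lebesgue. f1 x * \<phi> x) \<le> I * e" .
    have 2: "norm (f2 (\<lambda>x. \<kappa> x * \<phi> x)) \<le> C * e"
      using box_subset_cbox[of 0 L] by (intro CN(2)[OF \<phi> e] b) auto
    show "norm (sum_pairing (cbox 0 L) f1 f2 \<phi>) \<le> (I + C) * e"
      unfolding sum_pairing_def interior_cbox \<kappa>(2) distrib_right
      by (rule norm_triangle_mono[OF 1 2])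
  qed
qed

text \<open>A functional of finite order that kills the cosine waves kills their limits in the \<open>C\<^sup>N\<close> topology.\<close>

lemma functional_vanishes_on_test_funs:
  fixes L :: "real ^ 'n" and D :: "(real ^ 'n \<Rightarrow> complex) \<Rightarrow> complex"
  assumes L: "\<And>i. L $ i > 0"
    and lin: "\<And>\<phi> \<psi> a b. smooth \<phi> \<Longrightarrow> smooth \<psi> \<Longrightarrow> D (\<lambda>x. a * \<phi> x + b * \<psi> x) = a * D \<phi> + b * D \<psi>"
    and C: "C \<ge> 0"
    and bound: "\<And>\<phi> e. smooth \<phi> \<Longrightarrow> e \<ge> 0 \<Longrightarrow>
      (\<And>is x. length is \<le> N \<Longrightarrow> x \<in> cbox 0 L \<Longrightarrow> norm (iter_partial is \<phi> x) \<le> e) \<Longrightarrow> norm (D \<phi>) \<le> C * e"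
    and zero: "\<And>k. D (cosine_wave L k) = 0"
    and \<phi>: "\<phi> \<in> test_funs (box 0 L)"
  shows "D \<phi> = 0"
proof -
  have span: "D p = 0" if "p \<in> cosine_span L" for p
    using that
  proof (induction rule: cosine_span.induct)
    case (wave c k)
    then show ?case
      using lin[OF smooth_cosine_wave smooth_cosine_wave, of c L k 0 L k] by (simp add: zero)
  next
    case (add p q)
    then show ?case
      using lin[OF smooth_cosine_span smooth_cosine_span, of p L q L 1 1] by simp
  qed
  have "norm (D \<phi>) \<le> 0 + e" if e: "e > 0" for e
  proof -
    have "e / (C + 1) > 0" using e C by simp
    then obtain p where p: "p \<in> cosine_span L"
      "\<And>is x. length is \<le> N \<Longrightarrow> x \<in> cbox 0 L \<Longrightarrow> norm (iter_partial is (\<lambda>x. \<phi> x - p x) x) \<le> e / (C + 1)"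
      using test_funs_approximation[OF L \<phi>, of "e / (C + 1)" N] by blast
    have s: "smooth \<phi>" "smooth p" using \<phi> p test_funs_smooth smooth_cosine_span by blast+
    have "D \<phi> = D (\<lambda>x. \<phi> x - p x)"
      using lin[OF s, of 1 "-1"] span[OF p(1)] by simp
    also have "norm \<dots> \<le> C * (e / (C + 1))"
      by (rule bound[OF smooth_diff[OF s] _ p(2)]) (use e C in auto)
    also have "\<dots> \<le> e" using e C by (simp add: field_simps)
    finally show ?thesis by simp
  qed
  then have "norm (D \<phi>) \<le> 0" by (rule field_le_epsilon)
  then show ?thesis by simp
qed

text \<open>Cutoffs for \<open>K\<close> together with boxes that exhaust the open box.\<close>

lemma cutoff_sequence_exists:
  fixes L :: "real ^ 'n"
  assumes L: "\<And>i. L $ i > 0" and K: "compact K" "K \<subseteq> box 0 L"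
  obtains \<theta> :: "nat \<Rightarrow> real ^ 'n \<Rightarrow> real" where
    "\<And>m. (\<lambda>x. complex_of_real (\<theta> m x)) \<in> test_funs (box 0 L)"
    "\<And>m x. 0 \<le> \<theta> m x \<and> \<theta> m x \<le> 1" "\<And>m x. x \<in> K \<Longrightarrow> \<theta> m x = 1"
    "\<And>x. x \<in> box 0 L \<Longrightarrow> eventually (\<lambda>m. \<theta> m x = 1) sequentially"
proof -
  define a where "a m = (\<chi> i. L $ i / real (m + 2))" for m
  define J where "J m = cbox (a m) (L - a m)" for m
  have J: "J m \<subseteq> box 0 L" for m
  proof
    fix x assume x: "x \<in> J m"
    have "0 < a m $ i" for i using L[of i] by (simp add: a_def)
    moreover have "a m $ i \<le> x $ i \<and> x $ i \<le> L $ i - a m $ i" for i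
      using x by (simp add: J_def mem_box_cart)
    ultimately have "0 < x $ i \<and> x $ i < L $ i" for i by (smt (verit))
    then show "x \<in> box 0 L" by (simp add: mem_box_cart)
  qed
  have "\<exists>\<theta>. (\<lambda>x. complex_of_real (\<theta> x)) \<in> test_funs (box 0 L) \<and> (\<forall>x. 0 \<le> \<theta> x \<and> \<theta> x \<le> 1)
      \<and> (\<forall>x\<in>K \<union> J m. \<theta> x = 1)" for m
  proof -
    have "compact (K \<union> J m)" "K \<union> J m \<subseteq> box 0 L"
      using K J by (auto simp: J_def intro: compact_Un)
    then obtain \<theta> V where "(\<lambda>x. complex_of_real (\<theta> x)) \<in> test_funs (box 0 L)"
      "\<And>x. 0 \<le> \<theta> x" "\<And>x. \<theta> x \<le> 1" "open V" "K \<union> J m \<subseteq> V" "\<And>x. x \<in> V \<Longrightarrow> \<theta> x = 1"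
      by (rule smooth_cutoff_exists) (rule that)
    then show ?thesis by (intro exI[of _ \<theta>]) auto
  qed
  then obtain \<theta> where \<theta>: "\<And>m. (\<lambda>x. complex_of_real (\<theta> m x)) \<in> test_funs (box 0 L)"
     "\<And>m x. 0 \<le> \<theta> m x \<and> \<theta> m x \<le> 1" "\<And>m x. x \<in> K \<union> J m \<Longrightarrow> \<theta> m x = 1"
    by metis
  show thesis
  proof (rule that[OF \<theta>(1,2)])
    show "\<theta> m x = 1" if "x \<in> K" for m x using \<theta>(3) that by blast
    fix x assume x: "x \<in> box 0 L"
    have "eventually (\<lambda>m. a m $ i \<le> x $ i \<and> x $ i \<le> L $ i - a m $ i) sequentially" for i
    proof -
      have xi: "0 < x $ i" "0 < L $ i - x $ i" using x by (auto simp: mem_box_cart)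
      have "(\<lambda>m. L $ i / real (m + 2)) \<longlonglongrightarrow> 0"
        using LIMSEQ_ignore_initial_segment[OF lim_const_over_n[of "L $ i"], of 2] by simp
      then have "eventually (\<lambda>m. L $ i / real (m + 2) < min (x $ i) (L $ i - x $ i)) sequentially"
        using xi by (intro order_tendstoD) auto
      then show ?thesis by eventually_elim (auto simp: a_def)
    qed
    then have "eventually (\<lambda>m. \<forall>i. a m $ i \<le> x $ i \<and> x $ i \<le> L $ i - a m $ i) sequentially"
      by (rule eventually_all_finite)
    then show "eventually (\<lambda>m. \<theta> m x = 1) sequentially"
      by eventually_elim (auto simp: J_def mem_box_cart intro!: \<theta>(3))
  qed
qed

text \<open>Dominated convergence: the integrand is eventually zero off the boundary of the box, which is a
  null set.\<close>

lemma integral_off_cutoffs_tendsto_0: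
  fixes L :: "real ^ 'n" and f \<phi> :: "real ^ 'n \<Rightarrow> complex"
  assumes f: "f absolutely_integrable_on cbox 0 L" and \<phi>: "smooth \<phi>"
    and sm: "\<And>m. smooth (\<lambda>x. complex_of_real (\<theta> m x))"
    and \<theta>: "\<And>m x. 0 \<le> \<theta> m x \<and> \<theta> m x \<le> 1"
    and ev: "\<And>x. x \<in> box 0 L \<Longrightarrow> eventually (\<lambda>m. \<theta> m x = 1) sequentially"
  shows "(\<lambda>m. LINT x:cbox 0 L|lebesgue. f x * (\<phi> x - of_real (\<theta> m x) * \<phi> x)) \<longlonglongrightarrow> 0"
proof -
  have "compact (\<phi> ` cbox 0 L)"
    by (intro compact_continuous_image smooth_continuous_on \<phi> compact_cbox)
  then obtain B where B: "B > 0" "\<forall>y\<in>\<phi> ` cbox 0 L. norm y \<le> B"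
    using compact_imp_bounded bounded_pos by blast
  have int: "integrable lebesgue (\<lambda>x. indicator (cbox 0 L) x *\<^sub>R (f x * (\<phi> x - of_real (\<theta> m x) * \<phi> x)))" for m
  proof -
    have "(\<lambda>x. f x * (\<phi> x - of_real (\<theta> m x) * \<phi> x)) absolutely_integrable_on cbox 0 L"
      by (intro set_integrable_times_continuous f smooth_continuous_on smooth_diff smooth_mult \<phi> sm)
    then show ?thesis by (simp add: set_integrable_def)
  qed
  have "(\<lambda>m. integral\<^sup>L lebesgue (\<lambda>x. indicator (cbox 0 L) x *\<^sub>R (f x * (\<phi> x - of_real (\<theta> m x) * \<phi> x))))
      \<longlonglongrightarrow> integral\<^sup>L lebesgue (\<lambda>x::real^'n. 0::complex)"
  proof (rule integral_dominated_convergence[where w="\<lambda>x. norm (indicator (cbox 0 L) x *\<^sub>R f x) * B"])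
    show "integrable lebesgue (\<lambda>x. norm (indicator (cbox 0 L) x *\<^sub>R f x) * B)"
      using f by (intro integrable_mult_left integrable_norm) (simp add: set_integrable_def)
    show "(\<lambda>x. indicator (cbox 0 L) x *\<^sub>R (f x * (\<phi> x - of_real (\<theta> m x) * \<phi> x))) \<in> borel_measurable lebesgue" for m
      by (rule borel_measurable_integrable[OF int])
    have "cbox 0 L - box 0 L \<in> null_sets lebesgue"
      using negligible_frontier_interval negligible_iff_null_sets by blast
    then have "AE x in lebesgue. x \<notin> cbox 0 L - box 0 L" by (rule AE_not_in)
    then show "AE x in lebesgue. (\<lambda>m. indicator (cbox 0 L) x *\<^sub>R (f x * (\<phi> x - of_real (\<theta> m x) * \<phi> x))) \<longlonglongrightarrow> 0"
    proof eventually_elim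
      case (elim x)
      show ?case
      proof (cases "x \<in> box 0 L")
        case True
        from ev[OF this] show ?thesis
          by (intro tendsto_eventually) (auto elim: eventually_mono)
      next
        case False
        then show ?thesis using elim by simp
      qed
    qed
    show "AE x in lebesgue. norm (indicator (cbox 0 L) x *\<^sub>R (f x * (\<phi> x - of_real (\<theta> m x) * \<phi> x)))
        \<le> norm (indicator (cbox 0 L) x *\<^sub>R f x) * B" for m
    proof (rule AE_I2)
      fix x :: "real ^ 'n"
      show "norm (indicator (cbox 0 L) x *\<^sub>R (f x * (\<phi> x - of_real (\<theta> m x) * \<phi> x)))
        \<le> norm (indicator (cbox 0 L) x *\<^sub>R f x) * B"
      proof (cases "x \<in> cbox 0 L")
        case True
        have "\<phi> x - of_real (\<theta> m x) * \<phi> x = of_real (1 - \<theta> m x) * \<phi> x" by (simp add: algebra_simps)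
        then have "norm (\<phi> x - of_real (\<theta> m x) * \<phi> x) = (1 - \<theta> m x) * norm (\<phi> x)"
          using \<theta>[of m x] by (simp only: norm_mult norm_of_real) simp
        also have "\<dots> \<le> 1 * B"
          using \<theta>[of m x] B True by (intro mult_mono) auto
        finally show ?thesis
          using True by (simp add: norm_mult mult_left_mono)
      qed simp
    qed
  qed simp
  then show ?thesis by (simp add: set_lebesgue_integral_def)
qed

lemma sum_pairing_off_cutoff:
  fixes L :: "real ^ 'n"
  assumes f2: "distribution_on (box 0 L) f2"
    and \<kappa>: "\<And>\<phi>. smooth_action (box 0 L) f2 \<phi> = f2 (\<lambda>x. \<kappa> x * \<phi> x)"
    and \<psi>: "\<And>x. x \<in> fun_supp \<kappa> \<Longrightarrow> \<psi> x = 0"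
  shows "sum_pairing (cbox 0 L) f1 f2 \<psi> = (LINT x:cbox 0 L|lebesgue. f1 x * \<psi> x)"
proof -
  have "(\<lambda>x. \<kappa> x * \<psi> x) = (\<lambda>x. 0)"
    using \<psi> fun_supp_zero[of _ \<kappa>] by fastforce
  moreover have "(\<lambda>x. 0) \<in> test_funs (box 0 L)"
    by (simp add: test_funs_def smooth_const fun_supp_def)
  then have "f2 (\<lambda>x. 0) = 0"
    using distribution_on_linear[OF f2, of "\<lambda>x. 0" "\<lambda>x. 0" 0 0] by simp
  ultimately show ?thesis by (simp add: sum_pairing_def interior_cbox \<kappa>)
qed

theorem corollary6:
  fixes L :: "real ^ 'n"
    and f1 g1 :: "real ^ 'n \<Rightarrow> complex"
    and f2 g2 :: "(real ^ 'n \<Rightarrow> complex) \<Rightarrow> complex"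
  assumes "CARD('n) \<ge> 2"
    and "\<And>i. L $ i > 0"
    and "f1 absolutely_integrable_on billiard_box L"
    and "compactly_supported_distribution_on (interior (billiard_box L)) f2"
    and "g1 absolutely_integrable_on billiard_box L"
    and "compactly_supported_distribution_on (interior (billiard_box L)) g2"
    and "\<And>v \<eta>. v \<noteq> 0 \<Longrightarrow> \<eta> \<in> torus_test_funs \<Longrightarrow>
           billiard_integrals L f1 f2 v \<eta> = billiard_integrals L g1 g2 v \<eta>"
  shows "\<forall>\<phi>\<in>smooth_funs_on (billiard_box L).
           sum_pairing (billiard_box L) f1 f2 \<phi> = sum_pairing (billiard_box L) g1 g2 \<phi>"
proof
  note L = assms(2)
  have f1: "f1 absolutely_integrable_on cbox 0 L" and g1: "g1 absolutely_integrable_on cbox 0 L"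
    and f2: "compactly_supported_distribution_on (box 0 L) f2"
    and g2: "compactly_supported_distribution_on (box 0 L) g2"
    using assms(3-6) by (simp_all add: billiard_box_def interior_cbox)
  have df2: "distribution_on (box 0 L) f2" and dg2: "distribution_on (box 0 L) g2"
    using f2 g2 by (simp_all add: compactly_supported_distribution_on_def)
  define F where "F = sum_pairing (cbox 0 L) f1 f2"
  define G where "G = sum_pairing (cbox 0 L) g1 g2"
  define D where "D \<phi> = F \<phi> - G \<phi>" for \<phi>
  have lin: "D (\<lambda>x. a * \<phi> x + b * \<psi> x) = a * D \<phi> + b * D \<psi>" if "smooth \<phi>" "smooth \<psi>" for \<phi> \<psi> a b
    unfolding D_def F_def G_def sum_pairing_linear[OF f1 f2 that] sum_pairing_linear[OF g1 g2 that]
    by (simp add: algebra_simps)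
  \<comment> \<open>The exponential with frequency \<open>k\<close> is constant along a direction \<open>v\<close> orthogonal to \<open>k\<close>, so the
    integrals in that direction give the pairing with the cosine wave.\<close>
  have waves: "D (cosine_wave L k) = 0" for k
  proof -
    obtain v :: "int ^ 'n" where v: "v \<noteq> 0" "int_vec k \<bullet> int_vec v = 0"
      using orthogonal_int_vec_exists[OF assms(1)] by blast
    have "(\<Prod>i\<in>UNIV. 1 / (2 * L $ i)) \<noteq> 0"
      using L by (simp add: less_imp_neq[symmetric])
    with assms(7)[OF v(1) torus_plane_wave, of k] show ?thesis
      unfolding billiard_integrals_plane_wave[OF L v(2)]
      by (simp add: D_def F_def G_def billiard_box_def del: of_real_prod)
  qed
  have test: "D \<phi> = 0" if "\<phi> \<in> test_funs (box 0 L)" for \<phi>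
  proof -
    obtain C1 N1 where 1: "C1 \<ge> 0" "\<And>\<phi> e. smooth \<phi> \<Longrightarrow> e \<ge> 0 \<Longrightarrow>
      (\<And>is x. length is \<le> N1 \<Longrightarrow> x \<in> cbox 0 L \<Longrightarrow> norm (iter_partial is \<phi> x) \<le> e) \<Longrightarrow> norm (F \<phi>) \<le> C1 * e"
      using sum_pairing_bound[OF f1 f2] unfolding F_def by metis
    obtain C2 N2 where 2: "C2 \<ge> 0" "\<And>\<phi> e. smooth \<phi> \<Longrightarrow> e \<ge> 0 \<Longrightarrow>
      (\<And>is x. length is \<le> N2 \<Longrightarrow> x \<in> cbox 0 L \<Longrightarrow> norm (iter_partial is \<phi> x) \<le> e) \<Longrightarrow> norm (G \<phi>) \<le> C2 * e"
      using sum_pairing_bound[OF g1 g2] unfolding G_def by metis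
    show ?thesis
    proof (rule functional_vanishes_on_test_funs[OF L lin _ _ waves that, where C="C1 + C2" and N="max N1 N2"])
      fix \<phi> :: "real ^ 'n \<Rightarrow> complex" and e :: real
      assume \<phi>: "smooth \<phi>" and e: "e \<ge> 0"
        and b: "\<And>is x. length is \<le> max N1 N2 \<Longrightarrow> x \<in> cbox 0 L \<Longrightarrow> norm (iter_partial is \<phi> x) \<le> e"
      have "norm (F \<phi>) \<le> C1 * e" by (intro 1(2)[OF \<phi> e] b) auto
      moreover have "norm (G \<phi>) \<le> C2 * e" by (intro 2(2)[OF \<phi> e] b) auto
      ultimately show "norm (D \<phi>) \<le> (C1 + C2) * e"
        unfolding D_def distrib_right using norm_triangle_ineq4[of "F \<phi>" "G \<phi>"] by linarith
    qed (use 1 2 in auto)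
  qed
  obtain \<kappa> where \<kappa>: "\<kappa> \<in> test_funs (box 0 L)" "\<And>\<phi>. smooth_action (box 0 L) f2 \<phi> = f2 (\<lambda>x. \<kappa> x * \<phi> x)"
    using smooth_action_cutoff[OF f2] by blast
  obtain \<mu> where \<mu>: "\<mu> \<in> test_funs (box 0 L)" "\<And>\<phi>. smooth_action (box 0 L) g2 \<phi> = g2 (\<lambda>x. \<mu> x * \<phi> x)"
    using smooth_action_cutoff[OF g2] by blast
  \<comment> \<open>The cutoffs \<open>\<theta> m\<close> equal \<open>1\<close> on the supports of \<open>\<kappa>\<close> and \<open>\<mu>\<close>, so the distributional parts do not
    see \<open>(1 - \<theta> m) \<psi>\<close>.\<close>
  have "compact (fun_supp \<kappa> \<union> fun_supp \<mu>)" "fun_supp \<kappa> \<union> fun_supp \<mu> \<subseteq> box 0 L"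
    using \<kappa>(1) \<mu>(1) by (auto simp: test_funs_def)
  then obtain \<theta> where \<theta>: "\<And>m. (\<lambda>x. complex_of_real (\<theta> m x)) \<in> test_funs (box 0 L)"
    "\<And>m x. 0 \<le> \<theta> m x \<and> \<theta> m x \<le> 1" "\<And>m x. x \<in> fun_supp \<kappa> \<union> fun_supp \<mu> \<Longrightarrow> \<theta> m x = 1"
    "\<And>x. x \<in> box 0 L \<Longrightarrow> eventually (\<lambda>m::nat. \<theta> m x = 1) sequentially"
    using cutoff_sequence_exists[OF L] by metis
  have \<theta>s: "smooth (\<lambda>x. complex_of_real (\<theta> m x))" for m
    by (rule test_funs_smooth[OF \<theta>(1)])
  fix \<phi> assume "\<phi> \<in> smooth_funs_on (billiard_box L)"
  then obtain \<psi> where \<psi>: "smooth \<psi>" "\<And>x. x \<in> cbox 0 L \<Longrightarrow> \<phi> x = \<psi> x"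
    by (auto simp: smooth_funs_on_def billiard_box_def)
  have "D \<psi> = 0"
  proof -
    define I where "I h m = (LINT x:cbox 0 L|lebesgue. h x * (\<psi> x - of_real (\<theta> m x) * \<psi> x))"
      for h :: "real ^ 'n \<Rightarrow> complex" and m
    have "D \<psi> = I f1 m - I g1 m" for m
    proof -
      have "D \<psi> = D \<psi> - D (\<lambda>x. of_real (\<theta> m x) * \<psi> x)"
        using test[OF test_funs_mult[OF \<theta>(1) \<psi>(1)]] by simp
      also have "\<dots> = D (\<lambda>x. \<psi> x - of_real (\<theta> m x) * \<psi> x)"
        using lin[OF \<psi>(1) smooth_mult[OF \<theta>s \<psi>(1)], of 1 "-1"] by simp
      also have "\<dots> = I f1 m - I g1 m"
        unfolding D_def F_def G_def I_def
        using sum_pairing_off_cutoff[OF df2 \<kappa>(2), of "\<lambda>x. \<psi> x - of_real (\<theta> m x) * \<psi> x" f1]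
          sum_pairing_off_cutoff[OF dg2 \<mu>(2), of "\<lambda>x. \<psi> x - of_real (\<theta> m x) * \<psi> x" g1] \<theta>(3)
        by simp
      finally show ?thesis .
    qed
    moreover have "(\<lambda>m. I f1 m - I g1 m) \<longlonglongrightarrow> 0 - 0"
      unfolding I_def
      by (intro tendsto_diff integral_off_cutoffs_tendsto_0 f1 g1 \<psi>(1) \<theta>s \<theta>(2) \<theta>(4))
    ultimately show ?thesis
      by (simp add: LIMSEQ_const_iff flip: \<open>\<And>m. D \<psi> = I f1 m - I g1 m\<close>)
  qed
  moreover have "sum_pairing (cbox 0 L) h u \<phi> = sum_pairing (cbox 0 L) h u \<psi>"
    if \<nu>: "\<nu> \<in> test_funs (box 0 L)" "\<And>\<phi>. smooth_action (box 0 L) u \<phi> = u (\<lambda>x. \<nu> x * \<phi> x)" for h u \<nu>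
  proof -
    have "(\<lambda>x. \<nu> x * \<phi> x) = (\<lambda>x. \<nu> x * \<psi> x)"
      using test_funs_zero[OF \<nu>(1)] \<psi>(2) box_subset_cbox[of 0 L] by (metis mult_zero_left subsetD)
    moreover have "(LINT x:cbox 0 L|lebesgue. h x * \<phi> x) = (LINT x:cbox 0 L|lebesgue. h x * \<psi> x)"
      using \<psi>(2) by (intro set_lebesgue_integral_cong) auto
    ultimately show ?thesis by (simp add: sum_pairing_def interior_cbox \<nu>(2))
  qed
  ultimately show "sum_pairing (billiard_box L) f1 f2 \<phi> = sum_pairing (billiard_box L) g1 g2 \<phi>"
    using \<kappa> \<mu> by (simp add: billiard_box_def D_def F_def G_def)
qed

end
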